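(* Suppose that there is an elementary embedding $j\colon V \to M$ with $M$ transitive such that $\mathrm{crit}(j) = \kappa$ and ${}^{2^\kappa}j(\kappa)\subseteq M$. Let $\mathbb{P}$ be a ${<}\kappa$-strategically closed forcing notion of size $\kappa$. Then for every $p\in\mathbb{P}$ there is a $\kappa$-complete ultrafilter on $\mathbb{P}$ that extends $\mathcal{D}_p(\mathbb{P})$.
   Context: $\mathrm{crit}(j)$ denotes the critical point of $j$. ${}^{2^\kappa}j(\kappa)\subseteq M$ means every sequence of length $2^\kappa$ of ordinals below $j(\kappa)$ (in $V$) belongs to $M$. For a forcing $\mathbb{P}$ and $p\in\mathbb{P}$, $\mathcal{D}_p(\mathbb{P})$ is the filter generated by the dense open subsets of $\mathbb{P}$ together with the set $\{q\in\mathbb{P}\mid q\ge p\}$, where $q\ge p$ means $q$ is stronger than $p$. *)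

theory Defs
  imports Main
begin

text \<open>
  The universe \<open>V\<close> is an arbitrary first-order structure for the language of set theory: a type
  with a binary relation. Sets are its elements, and every quantifier over sets below ranges
  over the whole type. Classes (such as the target model \<open>M\<close> and the embedding \<open>j\<close>) are HOL sets
  and functions on that type.
\<close>

class set_structure =
  fixes mem :: "'a \<Rightarrow> 'a \<Rightarrow> bool" (infix "\<epsilon>" 50)

text \<open>
  First-order formulas over membership with two further symbols, a unary one for the class \<open>M\<close>
  and one for the graph of \<open>j\<close>. Variables are de Bruijn indices.
\<close>

datatype fm =
    Mem nat nat
  | Eq nat nat
  | InM nat
  | Graph nat nat
  | Neg fm
  | Conj fm fm
  | Forall fm

primrec pure_fm :: "fm \<Rightarrow> bool" where
  "pure_fm (Mem m n) = True"
| "pure_fm (Eq m n) = True"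
| "pure_fm (InM n) = False"
| "pure_fm (Graph m n) = False"
| "pure_fm (Neg \<phi>) = pure_fm \<phi>"
| "pure_fm (Conj \<phi> \<psi>) = (pure_fm \<phi> \<and> pure_fm \<psi>)"
| "pure_fm (Forall \<phi>) = pure_fm \<phi>"

text \<open>\<open>sat D M j\<close> is satisfaction in the structure with domain \<open>D\<close>.\<close>

primrec sat ::
  "'v::set_structure set \<Rightarrow> 'v set \<Rightarrow> ('v \<Rightarrow> 'v) \<Rightarrow> fm \<Rightarrow> (nat \<Rightarrow> 'v) \<Rightarrow> bool" where
  "sat D M j (Mem m n) env = (env m \<epsilon> env n)"
| "sat D M j (Eq m n) env = (env m = env n)"
| "sat D M j (InM n) env = (env n \<in> M)"
| "sat D M j (Graph m n) env = (env n = j (env m))"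
| "sat D M j (Neg \<phi>) env = (\<not> sat D M j \<phi> env)"
| "sat D M j (Conj \<phi> \<psi>) env = (sat D M j \<phi> env \<and> sat D M j \<psi> env)"
| "sat D M j (Forall \<phi>) env = (\<forall>x\<in>D. sat D M j \<phi> (case_nat x env))"

definition is_empty :: "'v::set_structure \<Rightarrow> bool" where
  "is_empty x \<longleftrightarrow> (\<forall>z. \<not> z \<epsilon> x)"

definition is_subset :: "'v::set_structure \<Rightarrow> 'v \<Rightarrow> bool" where
  "is_subset x y \<longleftrightarrow> (\<forall>z. z \<epsilon> x \<longrightarrow> z \<epsilon> y)"

definition is_upair :: "'v::set_structure \<Rightarrow> 'v \<Rightarrow> 'v \<Rightarrow> bool" where
  "is_upair z x y \<longleftrightarrow> (\<forall>w. w \<epsilon> z \<longleftrightarrow> w = x \<or> w = y)"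

definition is_succ :: "'v::set_structure \<Rightarrow> 'v \<Rightarrow> bool" where
  "is_succ y x \<longleftrightarrow> (\<forall>z. z \<epsilon> y \<longleftrightarrow> z \<epsilon> x \<or> z = x)"

text \<open>
  ZFC for the structure \<open>(V, \<epsilon>, M, j)\<close>: Extensionality, Foundation, Pairing, Union, Power Set,
  Infinity, Separation, Replacement and Choice. As usual for theorems about class embeddings, Separation
  and Replacement are available for formulas that mention \<open>M\<close> and \<open>j\<close>. When \<open>M\<close> and \<open>j\<close> are
  definable with parameters, this follows from ZFC for \<open>(V, \<epsilon>)\<close>.
\<close>

definition ZFC_model :: "'v::set_structure set \<Rightarrow> ('v \<Rightarrow> 'v) \<Rightarrow> bool" where
  "ZFC_model M j \<longleftrightarrow>
    (\<forall>x y::'v. (\<forall>z. z \<epsilon> x \<longleftrightarrow> z \<epsilon> y) \<longrightarrow> x = y) \<and>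
    (\<forall>x::'v. \<not> is_empty x \<longrightarrow> (\<exists>y. y \<epsilon> x \<and> \<not> (\<exists>z. z \<epsilon> x \<and> z \<epsilon> y))) \<and>
    (\<forall>x y::'v. \<exists>z. is_upair z x y) \<and>
    (\<forall>x::'v. \<exists>u. \<forall>z. z \<epsilon> u \<longleftrightarrow> (\<exists>y. y \<epsilon> x \<and> z \<epsilon> y)) \<and>
    (\<forall>x::'v. \<exists>p. \<forall>z. z \<epsilon> p \<longleftrightarrow> is_subset z x) \<and>
    (\<exists>i::'v. (\<exists>e. is_empty e \<and> e \<epsilon> i) \<and> (\<forall>x. x \<epsilon> i \<longrightarrow> (\<exists>y. is_succ y x \<and> y \<epsilon> i))) \<and>
    (\<forall>\<phi> env (a::'v). \<exists>b. \<forall>x. x \<epsilon> b \<longleftrightarrow> x \<epsilon> a \<and> sat UNIV M j \<phi> (case_nat x env)) \<and>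
    (\<forall>\<phi> env (a::'v).
      (\<forall>x. x \<epsilon> a \<longrightarrow> (\<exists>!y. sat UNIV M j \<phi> (case_nat x (case_nat y env)))) \<longrightarrow>
      (\<exists>b. \<forall>y. y \<epsilon> b \<longleftrightarrow> (\<exists>x. x \<epsilon> a \<and> sat UNIV M j \<phi> (case_nat x (case_nat y env))))) \<and>
    (\<forall>a::'v. (\<forall>x. x \<epsilon> a \<longrightarrow> \<not> is_empty x) \<and>
        (\<forall>x y. x \<epsilon> a \<and> y \<epsilon> a \<and> (\<exists>z. z \<epsilon> x \<and> z \<epsilon> y) \<longrightarrow> x = y) \<longrightarrow>
      (\<exists>c. \<forall>x. x \<epsilon> a \<longrightarrow> (\<exists>!z. z \<epsilon> x \<and> z \<epsilon> c)))"

definition transitive_class :: "'v::set_structure set \<Rightarrow> bool" where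
  "transitive_class M \<longleftrightarrow> (\<forall>x\<in>M. \<forall>y. y \<epsilon> x \<longrightarrow> y \<in> M)"

definition elementary_embedding :: "('v::set_structure \<Rightarrow> 'v) \<Rightarrow> 'v set \<Rightarrow> bool" where
  "elementary_embedding j M \<longleftrightarrow>
    (\<forall>x. j x \<in> M) \<and>
    (\<forall>\<phi> env. pure_fm \<phi> \<longrightarrow> (sat UNIV M j \<phi> env \<longleftrightarrow> sat M M j \<phi> (j \<circ> env)))"

text \<open>Kuratowski pairs; \<open>rel r x y\<close> says that the pair of \<open>x\<close> and \<open>y\<close> is an element of \<open>r\<close>.\<close>

definition is_opair :: "'v::set_structure \<Rightarrow> 'v \<Rightarrow> 'v \<Rightarrow> bool" where
  "is_opair z x y \<longleftrightarrow> (\<exists>a b. is_upair a x x \<and> is_upair b x y \<and> is_upair z a b)"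

definition rel :: "'v::set_structure \<Rightarrow> 'v \<Rightarrow> 'v \<Rightarrow> bool" where
  "rel r x y \<longleftrightarrow> (\<exists>z. z \<epsilon> r \<and> is_opair z x y)"

definition is_fun :: "'v::set_structure \<Rightarrow> 'v \<Rightarrow> 'v \<Rightarrow> bool" where
  "is_fun f a b \<longleftrightarrow>
    (\<forall>z. z \<epsilon> f \<longrightarrow> (\<exists>x y. x \<epsilon> a \<and> y \<epsilon> b \<and> is_opair z x y)) \<and>
    (\<forall>x. x \<epsilon> a \<longrightarrow> (\<exists>!y. rel f x y))"

definition is_bij :: "'v::set_structure \<Rightarrow> 'v \<Rightarrow> 'v \<Rightarrow> bool" where
  "is_bij f a b \<longleftrightarrow> is_fun f a b \<and> (\<forall>y. y \<epsilon> b \<longrightarrow> (\<exists>!x. rel f x y))"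

definition is_restriction :: "'v::set_structure \<Rightarrow> 'v \<Rightarrow> 'v \<Rightarrow> bool" where
  "is_restriction r f a \<longleftrightarrow> (\<forall>z. z \<epsilon> r \<longleftrightarrow> z \<epsilon> f \<and> (\<exists>x y. x \<epsilon> a \<and> is_opair z x y))"

definition is_trans :: "'v::set_structure \<Rightarrow> bool" where
  "is_trans x \<longleftrightarrow> (\<forall>y. y \<epsilon> x \<longrightarrow> is_subset y x)"

definition is_ordinal :: "'v::set_structure \<Rightarrow> bool" where
  "is_ordinal x \<longleftrightarrow> is_trans x \<and> (\<forall>y. y \<epsilon> x \<longrightarrow> is_trans y)"

definition is_cardinal :: "'v::set_structure \<Rightarrow> bool" where
  "is_cardinal k \<longleftrightarrow> is_ordinal k \<and> (\<forall>a. a \<epsilon> k \<longrightarrow> \<not> (\<exists>f. is_bij f a k))"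

definition is_card_of :: "'v::set_structure \<Rightarrow> 'v \<Rightarrow> bool" where
  "is_card_of k x \<longleftrightarrow> is_cardinal k \<and> (\<exists>f. is_bij f k x)"

definition is_two :: "'v::set_structure \<Rightarrow> bool" where
  "is_two t \<longleftrightarrow> (\<exists>z u. is_empty z \<and> is_succ u z \<and> is_succ t u)"

text \<open>\<open>l\<close> is the cardinal \<open>2\<^sup>k\<close>, the cardinality of the set of functions from \<open>k\<close> to \<open>2\<close>.\<close>

definition is_two_power :: "'v::set_structure \<Rightarrow> 'v \<Rightarrow> bool" where
  "is_two_power l k \<longleftrightarrow>
    (\<exists>t F. is_two t \<and> (\<forall>f. f \<epsilon> F \<longleftrightarrow> is_fun f k t) \<and> is_card_of l F)"

definition critical_point :: "('v::set_structure \<Rightarrow> 'v) \<Rightarrow> 'v \<Rightarrow> bool" where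
  "critical_point j k \<longleftrightarrow> is_ordinal k \<and> j k \<noteq> k \<and> (\<forall>a. a \<epsilon> k \<longrightarrow> j a = a)"

text \<open>
  A forcing notion is a set \<open>P\<close> preordered by \<open>R\<close>, where \<open>rel R p q\<close> means \<open>q \<ge> p\<close>, that is,
  \<open>q\<close> is stronger than \<open>p\<close>. No weakest condition is required.
\<close>

definition forcing_notion :: "'v::set_structure \<Rightarrow> 'v \<Rightarrow> bool" where
  "forcing_notion P R \<longleftrightarrow>
    (\<forall>p. p \<epsilon> P \<longrightarrow> rel R p p) \<and>
    (\<forall>p q r. p \<epsilon> P \<and> q \<epsilon> P \<and> r \<epsilon> P \<and> rel R p q \<and> rel R q r \<longrightarrow> rel R p r)"

text \<open>
  The game of length \<open>a\<close>: players I and II build an increasing sequence of conditions indexed by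
  the stages below \<open>a\<close>. Player I opens, the players alternate at successor stages, and II moves at
  all limit stages. A player who makes no legal move loses, and II wins if all stages below \<open>a\<close>
  are played. (This is the game in which II moves at the even stages and has to open with
  the weakest condition, with that trivial move omitted.) In the following definition \<open>e\<close>
  is the set of the stages up to \<open>s\<close> that belong to player I.
\<close>

definition stage_of_I :: "'v::set_structure \<Rightarrow> bool" where
  "stage_of_I s \<longleftrightarrow>
    (\<exists>e. s \<epsilon> e \<and>
      (\<forall>t. t \<epsilon> s \<or> t = s \<longrightarrow>
        (t \<epsilon> e \<longleftrightarrow> is_empty t \<or> (\<exists>u. is_succ t u \<and> \<not> u \<epsilon> e))))"

definition is_position :: "'v::set_structure \<Rightarrow> 'v \<Rightarrow> 'v \<Rightarrow> 'v \<Rightarrow> bool" where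
  "is_position P R b f \<longleftrightarrow>
    is_fun f b P \<and>
    (\<forall>s t x y. s \<epsilon> t \<and> t \<epsilon> b \<and> rel f s x \<and> rel f t y \<longrightarrow> rel R x y)"

definition follows :: "'v::set_structure \<Rightarrow> 'v \<Rightarrow> 'v \<Rightarrow> bool" where
  "follows \<tau> b f \<longleftrightarrow>
    (\<forall>s. s \<epsilon> b \<and> \<not> stage_of_I s \<longrightarrow>
      (\<exists>r y. is_restriction r f s \<and> rel \<tau> r y \<and> rel f s y))"

definition winning_strategy_II :: "'v::set_structure \<Rightarrow> 'v \<Rightarrow> 'v \<Rightarrow> 'v \<Rightarrow> bool" where
  "winning_strategy_II P R a \<tau> \<longleftrightarrow>
    (\<exists>d. is_fun \<tau> d P) \<and>
    (\<forall>b f. b \<epsilon> a \<and> \<not> stage_of_I b \<and> is_position P R b f \<and> follows \<tau> b f \<longrightarrow>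
      (\<exists>q. rel \<tau> f q \<and> (\<forall>s x. s \<epsilon> b \<and> rel f s x \<longrightarrow> rel R x q)))"

definition strategically_closed_below :: "'v::set_structure \<Rightarrow> 'v \<Rightarrow> 'v \<Rightarrow> bool" where
  "strategically_closed_below k P R \<longleftrightarrow> (\<forall>a. a \<epsilon> k \<longrightarrow> (\<exists>\<tau>. winning_strategy_II P R a \<tau>))"

definition dense_open :: "'v::set_structure \<Rightarrow> 'v \<Rightarrow> 'v \<Rightarrow> bool" where
  "dense_open P R D \<longleftrightarrow>
    is_subset D P \<and>
    (\<forall>p. p \<epsilon> P \<longrightarrow> (\<exists>q. q \<epsilon> D \<and> rel R p q)) \<and>
    (\<forall>p q. p \<epsilon> D \<and> q \<epsilon> P \<and> rel R p q \<longrightarrow> q \<epsilon> D)"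

text \<open>Filters on the set \<open>A\<close>, not necessarily proper.\<close>

definition is_filter :: "'v::set_structure \<Rightarrow> 'v \<Rightarrow> bool" where
  "is_filter A F \<longleftrightarrow>
    (\<forall>X. X \<epsilon> F \<longrightarrow> is_subset X A) \<and>
    A \<epsilon> F \<and>
    (\<forall>X Y. X \<epsilon> F \<and> is_subset X Y \<and> is_subset Y A \<longrightarrow> Y \<epsilon> F) \<and>
    (\<forall>X Y Z. X \<epsilon> F \<and> Y \<epsilon> F \<and> (\<forall>z. z \<epsilon> Z \<longleftrightarrow> z \<epsilon> X \<and> z \<epsilon> Y) \<longrightarrow> Z \<epsilon> F)"

definition is_ultrafilter :: "'v::set_structure \<Rightarrow> 'v \<Rightarrow> bool" where
  "is_ultrafilter A U \<longleftrightarrow>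
    is_filter A U \<and>
    (\<forall>X. is_empty X \<longrightarrow> \<not> X \<epsilon> U) \<and>
    (\<forall>X Y. is_subset X A \<and> (\<forall>z. z \<epsilon> Y \<longleftrightarrow> z \<epsilon> A \<and> \<not> z \<epsilon> X) \<longrightarrow> X \<epsilon> U \<or> Y \<epsilon> U)"

definition complete_filter :: "'v::set_structure \<Rightarrow> 'v \<Rightarrow> 'v \<Rightarrow> bool" where
  "complete_filter k A F \<longleftrightarrow>
    (\<forall>a S Y. a \<epsilon> k \<and> is_fun S a F \<and>
        (\<forall>z. z \<epsilon> Y \<longleftrightarrow> z \<epsilon> A \<and> (\<forall>i X. rel S i X \<longrightarrow> z \<epsilon> X)) \<longrightarrow>
      Y \<epsilon> F)"

text \<open>
  \<open>in_D P R p X\<close> says that \<open>X\<close> belongs to \<open>\<D>\<^sub>p(P)\<close>, the least filter on \<open>P\<close> that contains the dense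
  open sets and the cone of conditions stronger than \<open>p\<close>.
\<close>

definition D_generator :: "'v::set_structure \<Rightarrow> 'v \<Rightarrow> 'v \<Rightarrow> 'v \<Rightarrow> bool" where
  "D_generator P R p X \<longleftrightarrow> dense_open P R X \<or> (\<forall>q. q \<epsilon> X \<longleftrightarrow> q \<epsilon> P \<and> rel R p q)"

definition in_D :: "'v::set_structure \<Rightarrow> 'v \<Rightarrow> 'v \<Rightarrow> 'v \<Rightarrow> bool" where
  "in_D P R p X \<longleftrightarrow>
    (\<forall>F. is_filter P F \<and> (\<forall>Y. D_generator P R p Y \<longrightarrow> Y \<epsilon> F) \<longrightarrow> X \<epsilon> F)"

end

theory Submission imports Defs begin

text \<open>
  It suffices to find a master condition: some \<open>q \<ge> j p\<close> in \<open>j P\<close> that lies in \<open>j D\<close> for every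
  dense open \<open>D \<subseteq> P\<close>. Then \<open>{X \<subseteq> P. q \<in> j X}\<close> is the required ultrafilter, with
  \<open>\<kappa>\<close>-completeness because \<open>j\<close> fixes all sequence indices below \<open>\<kappa>\<close>.

  There are at most \<open>\<mu> = 2\<^sup>\<kappa>\<close> dense open sets. For \<open>a, b < \<kappa>\<close> there is no injection of \<open>\<kappa>\<close> into the set
  of functions from \<open>a\<close> to \<open>b\<close>, so that set is bijective with an ordinal below \<open>\<kappa>\<close>. By
  elementarity \<open>M\<close> has a bijection between an ordinal below \<open>j \<kappa>\<close> and its functions from \<open>\<kappa>\<close> to \<open>2\<close>.
  By closure these are all functions from \<open>\<kappa>\<close> to \<open>2\<close>, hence \<open>\<mu> < j \<kappa>\<close>. So \<open>M\<close> has a winning strategy for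
  II in the game of length \<open>\<mu> + 1\<close> on \<open>j P\<close>. In \<open>V\<close>, player I plays against it, entering the sets \<open>j D\<close>
  one after the other; every proper initial segment of the play is a sequence of length at most
  \<open>\<mu>\<close> in \<open>j P\<close>, which \<open>M\<close> enumerates in type \<open>j \<kappa>\<close>, so it belongs to \<open>M\<close> and the strategy can
  answer. The move at stage \<open>\<mu>\<close> is \<open>q\<close>.

  Since \<open>V\<close> is an arbitrary model of first-order set theory, sets can only be formed from classes that
  are definable by formulas: \<open>definable\<close> and \<open>transfers\<close> reflect HOL predicates into formulas.
\<close>


section \<open>Renaming of variables, and environments that interleave variables with
  parameters\<close>

primrec rename_fm :: "(nat \<Rightarrow> nat) \<Rightarrow> fm \<Rightarrow> fm" where
  "rename_fm r (Mem m n) = Mem (r m) (r n)"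
| "rename_fm r (Eq m n) = Eq (r m) (r n)"
| "rename_fm r (InM n) = InM (r n)"
| "rename_fm r (Graph m n) = Graph (r m) (r n)"
| "rename_fm r (Neg \<phi>) = Neg (rename_fm r \<phi>)"
| "rename_fm r (Conj \<phi> \<psi>) = Conj (rename_fm r \<phi>) (rename_fm r \<psi>)"
| "rename_fm r (Forall \<phi>) = Forall (rename_fm (case_nat 0 (\<lambda>n. Suc (r n))) \<phi>)"

lemma pure_rename_fm [simp]: "pure_fm (rename_fm r \<phi>) = pure_fm \<phi>"
  by (induction \<phi> arbitrary: r) auto

lemma sat_rename_fm: "sat D M j (rename_fm r \<phi>) env = sat D M j \<phi> (\<lambda>n. env (r n))"
proof (induction \<phi> arbitrary: r env)
  case (Forall \<phi>)
  have "(\<lambda>n. case_nat x env (case n of 0 \<Rightarrow> 0 | Suc n \<Rightarrow> Suc (r n))) = case_nat x (\<lambda>n. env (r n))" for x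
    by (auto simp: fun_eq_iff split: nat.splits)
  with Forall show ?case by simp
qed auto

text \<open>Even positions hold variables, odd positions hold parameters.\<close>

definition join :: "(nat \<Rightarrow> 'v) \<Rightarrow> (nat \<Rightarrow> 'v) \<Rightarrow> nat \<Rightarrow> 'v" where
  "join c e n = (if even n then e (n div 2) else c (n div 2))"

lemma join_simps [simp]: "join c e (2 * n) = e n" "join c e (Suc (2 * n)) = c n"
  by (auto simp: join_def)

text \<open>Prepending a value to \<open>join c e\<close> moves every variable to an odd position
  and every parameter to a positive even one. This permutation fixes 0 and exchanges 2k+1 with 2k+2,
  which restores the parity convention with the new value as variable 0.\<close>

definition swap_var :: "nat \<Rightarrow> nat" where
  "swap_var n = (if n = 0 then 0 else if even n then n - 1 else Suc n)"

lemma join_case_nat: "join c (case_nat x e) = (\<lambda>n. case_nat x (join c e) (swap_var n))"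
proof
  fix n show "join c (case_nat x e) n = case_nat x (join c e) (swap_var n)"
  proof (cases "even n")
    case True then obtain k where "n = 2 * k" by blast
    then show ?thesis by (cases k) (auto simp: swap_var_def join_def)
  next
    case False then obtain k where "n = 2 * k + 1" by (blast elim: oddE)
    then show ?thesis by (auto simp: swap_var_def)
  qed
qed

text \<open>Two formulas with separate parameter sequences are combined by interleaving these
  sequences: \<open>ren_left\<close> sends parameter k to parameter 2k, and \<open>ren_right\<close>
  sends it to parameter 2k+1.\<close>

definition ren_left :: "nat \<Rightarrow> nat" where
  "ren_left n = (if even n then n else Suc (2 * (n - 1)))"

definition ren_right :: "nat \<Rightarrow> nat" where
  "ren_right n = (if even n then n else Suc (2 * n))"

lemma join_left: "join c e = (\<lambda>n. join (join d c) e (ren_left n))"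
  by (auto simp: join_def ren_left_def fun_eq_iff elim!: oddE)

lemma join_right: "join d e = (\<lambda>n. join (join d c) e (ren_right n))"
  by (auto simp: join_def ren_right_def fun_eq_iff elim!: oddE)

lemma join_map: "(\<lambda>n. f (join d c n)) = join (\<lambda>n. f (d n)) (\<lambda>n. f (c n))"
  by (auto simp: join_def fun_eq_iff)

definition ren_vars :: "(nat \<Rightarrow> nat) \<Rightarrow> nat \<Rightarrow> nat" where
  "ren_vars r n = (if even n then 2 * r (n div 2) else n)"

lemma join_ren_vars: "join c (\<lambda>n. e (r n)) = (\<lambda>n. join c e (ren_vars r n))"
  by (auto simp: join_def ren_vars_def fun_eq_iff)

locale zfc_structure =
  fixes M :: "'v::set_structure set" and j :: "'v \<Rightarrow> 'v"
  assumes zfc: "ZFC_model M j"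
begin

section \<open>Definable classes\<close>

text \<open>A whole sequence of parameters is supplied for uniformity, although a formula mentions
  only finitely many of them. Formulas may use the symbols for \<open>M\<close> and
  \<open>j\<close>, in accordance with the schemes in \<open>ZFC_model\<close>.\<close>

definition definable :: "((nat \<Rightarrow> 'v) \<Rightarrow> bool) \<Rightarrow> bool" where
  "definable Q \<longleftrightarrow> (\<exists>\<phi> c. \<forall>e. sat UNIV M j \<phi> (join c e) = Q e)"

definition definable_term :: "((nat \<Rightarrow> 'v) \<Rightarrow> 'v) \<Rightarrow> bool" where
  "definable_term t \<longleftrightarrow> definable (\<lambda>e. e 0 = t (\<lambda>n. e (Suc n)))"

lemma definable_rename: "definable Q \<Longrightarrow> definable (\<lambda>e. Q (\<lambda>n. e (r n)))"
  unfolding definable_def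
proof (elim exE)
  fix \<phi> c assume "\<forall>e. sat UNIV M j \<phi> (join c e) = Q e"
  then have "\<forall>e. sat UNIV M j (rename_fm (ren_vars r) \<phi>) (join c e) = Q (\<lambda>n. e (r n))"
    by (simp add: sat_rename_fm flip: join_ren_vars)
  then show "\<exists>\<phi> c. \<forall>e. sat UNIV M j \<phi> (join c e) = Q (\<lambda>n. e (r n))" by blast
qed

lemma definable_not: "definable Q \<Longrightarrow> definable (\<lambda>e. \<not> Q e)"
  unfolding definable_def
proof (elim exE)
  fix \<phi> c assume "\<forall>e. sat UNIV M j \<phi> (join c e) = Q e"
  then have "\<forall>e. sat UNIV M j (Neg \<phi>) (join c e) = (\<not> Q e)" by simp
  then show "\<exists>\<phi> c. \<forall>e. sat UNIV M j \<phi> (join c e) = (\<not> Q e)" by blast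
qed

lemma definable_conj:
  assumes "definable Q" "definable S" shows "definable (\<lambda>e. Q e \<and> S e)"
proof -
  obtain \<phi> c \<psi> d where "\<And>e. sat UNIV M j \<phi> (join c e) = Q e" "\<And>e. sat UNIV M j \<psi> (join d e) = S e"
    using assms unfolding definable_def by metis
  then have "\<forall>e. sat UNIV M j (Conj (rename_fm ren_left \<phi>) (rename_fm ren_right \<psi>)) (join (join d c) e)
      = (Q e \<and> S e)"
    by (simp add: sat_rename_fm flip: join_left join_right)
  then show ?thesis unfolding definable_def by blast
qed

text \<open>The predicate \<open>Q\<close> takes the bound value and the outer environment
  separately, so that the rule matches a HOL quantifier directly and turns its bound variable into
  index 0.\<close>

lemma definable_all:
  assumes "definable (\<lambda>e. Q (e 0) (\<lambda>n. e (Suc n)))" shows "definable (\<lambda>e. \<forall>x. Q x e)"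
proof -
  obtain \<phi> c where \<phi>: "\<And>e. sat UNIV M j \<phi> (join c e) = Q (e 0) (\<lambda>n. e (Suc n))"
    using assms unfolding definable_def by metis
  have "sat UNIV M j (rename_fm swap_var \<phi>) (case_nat x (join c e)) = Q x e" for x e
    using \<phi>[of "case_nat x e"] by (simp add: sat_rename_fm flip: join_case_nat)
  then have "\<forall>e. sat UNIV M j (Forall (rename_fm swap_var \<phi>)) (join c e) = (\<forall>x. Q x e)"
    by simp
  then show ?thesis unfolding definable_def by blast
qed

lemma definable_const: "definable (\<lambda>_. A)"
proof -
  have T: "definable (\<lambda>_. True)"
    unfolding definable_def by (rule exI[of _ "Eq 0 0"]) simp
  show ?thesis using T definable_not[OF T] by (cases A) auto
qed

lemma definable_imp: "definable Q \<Longrightarrow> definable S \<Longrightarrow> definable (\<lambda>e. Q e \<longrightarrow> S e)"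
  using definable_not[OF definable_conj[OF _ definable_not, of Q S]] by simp

lemma definable_disj: "definable Q \<Longrightarrow> definable S \<Longrightarrow> definable (\<lambda>e. Q e \<or> S e)"
  using definable_imp[OF definable_not, of Q S] by (simp add: disj_imp)

lemma definable_iff: "definable Q \<Longrightarrow> definable S \<Longrightarrow> definable (\<lambda>e. Q e \<longleftrightarrow> S e)"
  using definable_conj[OF definable_imp definable_imp, of Q S S Q] by (simp add: iff_conv_conj_imp)

lemma definable_ex:
  "definable (\<lambda>e. Q (e 0) (\<lambda>n. e (Suc n))) \<Longrightarrow> definable (\<lambda>e. \<exists>x. Q x e)"
  using definable_not[OF definable_all[OF definable_not], of Q] by simp

text \<open>Substituting a term amounts to asserting that some x equals the term and satisfies the
  predicate, and the graph of the term is definable.\<close>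

lemma definable_subst:
  assumes "definable_term t" "definable (\<lambda>e. Q (e 0) (\<lambda>n. e (Suc n)))"
  shows "definable (\<lambda>e. Q (t e) e)"
proof -
  have "definable (\<lambda>e. \<exists>x. x = t e \<and> Q x e)"
    by (intro definable_ex definable_conj assms(1)[unfolded definable_term_def] assms(2))
  then show ?thesis by simp
qed

lemma definable_term_rename: "definable_term t \<Longrightarrow> definable_term (\<lambda>e. t (\<lambda>n. e (r n)))"
  unfolding definable_term_def
  by (drule definable_rename[of _ "case_nat 0 (\<lambda>n. Suc (r n))"]) simp

lemma definable_mem_var: "definable (\<lambda>e. e m \<epsilon> e n)"
proof -
  have "\<forall>e. sat UNIV M j (Mem (2 * m) (2 * n)) (join c e) = (e m \<epsilon> e n)" for c by simp
  then show ?thesis unfolding definable_def by blast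
qed

lemma definable_eq_var: "definable (\<lambda>e. e m = e n)"
proof -
  have "\<forall>e. sat UNIV M j (Eq (2 * m) (2 * n)) (join c e) = (e m = e n)" for c by simp
  then show ?thesis unfolding definable_def by blast
qed

lemma definable_graph_var: "definable (\<lambda>e. e m = j (e n))"
proof -
  have "\<forall>e. sat UNIV M j (Graph (2 * n) (2 * m)) (join c e) = (e m = j (e n))" for c by simp
  then show ?thesis unfolding definable_def by blast
qed

lemma definable_eq_const: "definable (\<lambda>e. e m = a)"
proof -
  have "\<forall>e. sat UNIV M j (Eq (2 * m) 1) (join (\<lambda>_. a) e) = (e m = a)"
    by (simp add: join_def)
  then show ?thesis unfolding definable_def by blast
qed

lemma definable_term_var: "definable_term (\<lambda>e. e n)"
  unfolding definable_term_def by (rule definable_eq_var)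

lemma definable_term_const: "definable_term (\<lambda>_. a)"
  unfolding definable_term_def by (rule definable_eq_const)

lemma definable_mem:
  assumes "definable_term t" "definable_term s" shows "definable (\<lambda>e. t e \<epsilon> s e)"
  by (rule definable_subst[OF assms(1)], rule definable_subst[OF definable_term_rename[OF assms(2)]])
    (rule definable_mem_var)

lemma definable_eq:
  assumes "definable_term t" "definable_term s" shows "definable (\<lambda>e. t e = s e)"
  by (rule definable_subst[OF assms(1)], rule definable_subst[OF definable_term_rename[OF assms(2)]])
    (rule definable_eq_var)

lemma definable_ex1:
  assumes "definable (\<lambda>e. Q (e 0) (\<lambda>n. e (Suc n)))"
  shows "definable (\<lambda>e. \<exists>!x. Q x e)"
proof -
  have "definable (\<lambda>e. Q (e 0) (\<lambda>n. e (Suc (Suc n))))"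
    using definable_rename[OF assms, of "case_nat 0 (\<lambda>n. Suc (Suc n))"] by simp
  then show ?thesis
    unfolding Ex1_def
    by (intro definable_ex definable_conj definable_all definable_imp definable_eq definable_term_var assms)
qed

lemma definable_term_subst:
  assumes "definable_term t" "definable_term (\<lambda>e. G (e 0) (\<lambda>n. e (Suc n)))"
  shows "definable_term (\<lambda>e. G (t e) e)"
proof -
  have "definable (\<lambda>e. e (Suc 0) = G (e 0) (\<lambda>n. e (Suc (Suc n))))"
    using definable_rename[OF assms(2)[unfolded definable_term_def],
      of "case_nat 1 (case_nat 0 (\<lambda>n. Suc (Suc n)))"]
    by simp
  then show ?thesis
    unfolding definable_term_def
    by (intro definable_subst[OF definable_term_rename[OF assms(1)], where Q = "\<lambda>x e. e 0 = G x (\<lambda>n. e (Suc n))"])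
qed

lemma definable_term_embedding: "definable_term t \<Longrightarrow> definable_term (\<lambda>e. j (t e))"
  by (rule definable_term_subst, assumption) (unfold definable_term_def, rule definable_graph_var)

lemma definable_term_if:
  assumes "definable C" "definable_term t" "definable_term s"
  shows "definable_term (\<lambda>e. if C e then t e else s e)"
proof -
  have "definable (\<lambda>e. (C (\<lambda>n. e (Suc n)) \<longrightarrow> e 0 = t (\<lambda>n. e (Suc n))) \<and>
      (\<not> C (\<lambda>n. e (Suc n)) \<longrightarrow> e 0 = s (\<lambda>n. e (Suc n))))"
    using assms unfolding definable_term_def
    by (intro definable_conj definable_imp definable_not definable_rename[of C Suc])
  then show ?thesis unfolding definable_term_def by (rule back_subst[of definable]) auto
qed

text \<open>A definite description whose default value does not depend on \<open>Q\<close>, so that it is definable.\<close>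

definition the_set :: "('v \<Rightarrow> bool) \<Rightarrow> 'v" where
  "the_set Q = (if \<exists>!x. Q x then THE x. Q x else undefined)"

lemma the_setI: "\<exists>!x. Q x \<Longrightarrow> Q (the_set Q)"
  unfolding the_set_def by (simp add: theI')

lemma definable_term_the_set:
  assumes "definable (\<lambda>e. Q (\<lambda>n. e (Suc n)) (e 0))"
  shows "definable_term (\<lambda>e. the_set (Q e))"
proof -
  have *: "definable (\<lambda>e. \<exists>!x. Q e x)"
    by (rule definable_ex1) (rule assms)
  have "definable (\<lambda>e. ((\<exists>!x. Q (\<lambda>n. e (Suc n)) x) \<longrightarrow> Q (\<lambda>n. e (Suc n)) (e 0)) \<and>
     (\<not> (\<exists>!x. Q (\<lambda>n. e (Suc n)) x) \<longrightarrow> e 0 = undefined))"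
    by (intro definable_conj definable_imp definable_not definable_rename[OF *, of Suc] assms
        definable_eq_const)
  moreover have "(x = the_set S) = (((\<exists>!x. S x) \<longrightarrow> S x) \<and> (\<not> (\<exists>!x. S x) \<longrightarrow> x = undefined))" for x S
    using the_setI[of S] the_set_def[of S] by auto
  ultimately show ?thesis unfolding definable_term_def by simp
qed

named_theorems definable_intro

lemmas [definable_intro] = definable_const definable_not definable_conj definable_disj definable_imp
  definable_iff definable_all definable_ex definable_ex1 definable_mem definable_eq
  definable_term_var definable_term_const definable_term_embedding definable_term_if
  definable_term_the_set

text \<open>With this rule and its analogues for more arguments, a notion has to be unfolded only
  once, at plain variables; afterwards it is available for arbitrary definable terms.\<close>

lemma definable1:
  assumes "definable (\<lambda>e. N (e 0))" "definable_term t"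
  shows "definable (\<lambda>e. N (t e))"
  by (rule definable_subst[OF assms(2,1)])

lemma definable2:
  assumes "definable (\<lambda>e. N (e 0) (e 1))" "definable_term t" "definable_term s"
  shows "definable (\<lambda>e. N (t e) (s e))"
  by (rule definable_subst[OF assms(2)], rule definable_subst[OF definable_term_rename[OF assms(3)]])
    (use definable_rename[OF assms(1), of "case_nat 1 (\<lambda>_. 0)"] in simp)

lemma definable3:
  assumes "definable (\<lambda>e. N (e 0) (e 1) (e 2))" "definable_term t" "definable_term s" "definable_term u"
  shows "definable (\<lambda>e. N (t e) (s e) (u e))"
  by (rule definable_subst[OF assms(2)], rule definable_subst[OF definable_term_rename[OF assms(3)]],
      rule definable_subst[OF definable_term_rename[OF definable_term_rename[OF assms(4)]]])
    (use definable_rename[OF assms(1), of "case_nat 2 (case_nat 1 (\<lambda>_. 0))"] in \<open>simp add: numeral_2_eq_2\<close>)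

lemma definable_term1:
  assumes "definable_term (\<lambda>e. G (e 0))" "definable_term t"
  shows "definable_term (\<lambda>e. G (t e))"
  by (rule definable_term_subst[OF assms(2,1)])

lemma definable_term2:
  assumes "definable_term (\<lambda>e. G (e 0) (e 1))" "definable_term t" "definable_term s"
  shows "definable_term (\<lambda>e. G (t e) (s e))"
  by (rule definable_term_subst[OF assms(2)],
      rule definable_term_subst[OF definable_term_rename[OF assms(3)]])
    (use definable_term_rename[OF assms(1), of "case_nat 1 (\<lambda>_. 0)"] in simp)

section \<open>Basic set operations\<close>

lemma set_ext: "(\<And>z. z \<epsilon> x \<longleftrightarrow> z \<epsilon> y) \<Longrightarrow> x = (y::'v)"
  using zfc unfolding ZFC_model_def by simp

lemma foundation: "z \<epsilon> (x::'v) \<Longrightarrow> \<exists>y. y \<epsilon> x \<and> (\<forall>z. z \<epsilon> x \<longrightarrow> \<not> z \<epsilon> y)"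
  using zfc unfolding ZFC_model_def is_empty_def by meson

lemma is_upair_exists: "\<exists>z::'v. is_upair z x y"
  using zfc unfolding ZFC_model_def by simp

lemma union_exists: "\<exists>u::'v. \<forall>z. z \<epsilon> u \<longleftrightarrow> (\<exists>y. y \<epsilon> x \<and> z \<epsilon> y)"
  using zfc unfolding ZFC_model_def by simp

lemma power_exists: "\<exists>p::'v. \<forall>z. z \<epsilon> p \<longleftrightarrow> is_subset z x"
  using zfc unfolding ZFC_model_def by simp

lemma choice_set:
  assumes "\<And>x. x \<epsilon> (a::'v) \<Longrightarrow> \<exists>z. z \<epsilon> x"
    and "\<And>x y z. x \<epsilon> a \<Longrightarrow> y \<epsilon> a \<Longrightarrow> z \<epsilon> x \<Longrightarrow> z \<epsilon> y \<Longrightarrow> x = y"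
  shows "\<exists>c. \<forall>x. x \<epsilon> a \<longrightarrow> (\<exists>!z. z \<epsilon> x \<and> z \<epsilon> c)"
proof -
  have "\<forall>a::'v. (\<forall>x. x \<epsilon> a \<longrightarrow> \<not> is_empty x) \<and>
        (\<forall>x y. x \<epsilon> a \<and> y \<epsilon> a \<and> (\<exists>z. z \<epsilon> x \<and> z \<epsilon> y) \<longrightarrow> x = y) \<longrightarrow>
      (\<exists>c. \<forall>x. x \<epsilon> a \<longrightarrow> (\<exists>!z. z \<epsilon> x \<and> z \<epsilon> c))"
    using zfc unfolding ZFC_model_def by (elim conjE)
  then show ?thesis using assms unfolding is_empty_def by (elim allE[of _ a]) blast
qed

lemma separation:
  assumes "definable (\<lambda>e. Q (e 0))"
  shows "\<exists>b::'v. \<forall>x. x \<epsilon> b \<longleftrightarrow> x \<epsilon> a \<and> Q x"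
proof -
  obtain \<phi> c where \<phi>: "\<And>e. sat UNIV M j \<phi> (join c e) = Q (e 0)"
    using assms unfolding definable_def by metis
  \<comment> \<open>Only variable 0 matters to \<open>Q\<close>, so the remaining variables are
    filled with \<open>c\<close>.\<close>
  have "sat UNIV M j (rename_fm swap_var \<phi>) (case_nat x (join c c)) = Q x" for x
    using \<phi>[of "case_nat x c"] by (simp add: sat_rename_fm flip: join_case_nat)
  moreover have "\<exists>b. \<forall>x. x \<epsilon> b \<longleftrightarrow> x \<epsilon> a \<and> sat UNIV M j \<psi> (case_nat x e)" for \<psi> e
    using zfc unfolding ZFC_model_def by (elim conjE) blast
  ultimately show ?thesis by metis
qed

lemma replacement:
  assumes "definable_term (\<lambda>e. G (e 0))"
  shows "\<exists>b::'v. \<forall>y. y \<epsilon> b \<longleftrightarrow> (\<exists>x. x \<epsilon> a \<and> y = G x)"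
proof -
  have "definable (\<lambda>e. e 1 = G (e 0))"
    using definable_rename[OF assms[unfolded definable_term_def], of "case_nat 1 (\<lambda>_. 0)"] by simp
  then obtain \<phi> c where \<phi>: "\<And>e. sat UNIV M j \<phi> (join c e) = (e 1 = G (e 0))"
    unfolding definable_def by metis
  \<comment> \<open>Replacement prepends two values, so \<open>swap_var\<close> is applied once and
    then again to the positions behind the first value.\<close>
  let ?r = "\<lambda>n. case swap_var n of 0 \<Rightarrow> 0 | Suc n \<Rightarrow> Suc (swap_var n)"
  have eq: "sat UNIV M j (rename_fm ?r \<phi>) (case_nat x (case_nat y (join c c))) = (y = G x)" for x y
  proof -
    have "(\<lambda>n. case_nat x (case_nat y (join c c)) (?r n)) = join c (case_nat x (case_nat y c))"
      unfolding join_case_nat by (auto simp: fun_eq_iff split: nat.splits)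
    then show ?thesis
      using \<phi>[of "case_nat x (case_nat y c)"] by (simp add: sat_rename_fm)
  qed
  have "\<forall>\<phi> env (a::'v).
      (\<forall>x. x \<epsilon> a \<longrightarrow> (\<exists>!y. sat UNIV M j \<phi> (case_nat x (case_nat y env)))) \<longrightarrow>
      (\<exists>b. \<forall>y. y \<epsilon> b \<longleftrightarrow> (\<exists>x. x \<epsilon> a \<and> sat UNIV M j \<phi> (case_nat x (case_nat y env))))"
    using zfc unfolding ZFC_model_def by (elim conjE)
  from this[rule_format, of a "rename_fm ?r \<phi>" "join c c"] show ?thesis
    unfolding eq by simp
qed

text \<open>Like the operations that follow, this is a description by \<open>the_set\<close>, which
  makes it a definable term. It has the intended members as soon as the described set exists; for
  \<open>sep\<close> that requires a definable \<open>Q\<close>.\<close>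

definition sep :: "'v \<Rightarrow> ('v \<Rightarrow> bool) \<Rightarrow> 'v" where
  "sep a Q = the_set (\<lambda>b. \<forall>x. x \<epsilon> b \<longleftrightarrow> x \<epsilon> a \<and> Q x)"

definition Un_set :: "'v \<Rightarrow> 'v" where
  "Un_set x = the_set (\<lambda>u. \<forall>z. z \<epsilon> u \<longleftrightarrow> (\<exists>y. y \<epsilon> x \<and> z \<epsilon> y))"

definition Pow_set :: "'v \<Rightarrow> 'v" where
  "Pow_set x = the_set (\<lambda>p. \<forall>z. z \<epsilon> p \<longleftrightarrow> is_subset z x)"

definition upair :: "'v \<Rightarrow> 'v \<Rightarrow> 'v" where
  "upair x y = the_set (\<lambda>z. is_upair z x y)"

definition pair :: "'v \<Rightarrow> 'v \<Rightarrow> 'v" where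
  "pair x y = upair (upair x x) (upair x y)"

definition suc :: "'v \<Rightarrow> 'v" where
  "suc x = Un_set (upair x (upair x x))"

definition zero :: 'v where "zero = the_set is_empty"

definition image_set :: "'v \<Rightarrow> ('v \<Rightarrow> 'v) \<Rightarrow> 'v" where
  "image_set a G = the_set (\<lambda>b. \<forall>y. y \<epsilon> b \<longleftrightarrow> (\<exists>x. x \<epsilon> a \<and> y = G x))"

definition ap :: "'v \<Rightarrow> 'v \<Rightarrow> 'v" where
  "ap f x = the_set (\<lambda>y. pair x y \<epsilon> f)"

lemma the_set_mem:
  "\<exists>b::'v. \<forall>x. x \<epsilon> b \<longleftrightarrow> C x \<Longrightarrow> y \<epsilon> the_set (\<lambda>b. \<forall>x. x \<epsilon> b \<longleftrightarrow> C x) \<longleftrightarrow> C y"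
proof -
  assume "\<exists>b::'v. \<forall>x. x \<epsilon> b \<longleftrightarrow> C x"
  then have "\<exists>!b::'v. \<forall>x. x \<epsilon> b \<longleftrightarrow> C x" by (blast intro: set_ext)
  from the_setI[OF this] show ?thesis by blast
qed

lemma mem_sep: "definable (\<lambda>e. Q (e 0)) \<Longrightarrow> x \<epsilon> sep a Q \<longleftrightarrow> x \<epsilon> a \<and> Q x"
  unfolding sep_def by (rule the_set_mem[OF separation])

lemma mem_image_set: "definable_term (\<lambda>e. G (e 0)) \<Longrightarrow> y \<epsilon> image_set a G \<longleftrightarrow> (\<exists>x. x \<epsilon> a \<and> y = G x)"
  unfolding image_set_def by (rule the_set_mem[OF replacement])

lemma mem_Un_set [simp]: "z \<epsilon> Un_set x \<longleftrightarrow> (\<exists>y. y \<epsilon> x \<and> z \<epsilon> y)"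
  unfolding Un_set_def by (rule the_set_mem[OF union_exists])

lemma mem_Pow_set [simp]: "z \<epsilon> Pow_set x \<longleftrightarrow> is_subset z x"
  unfolding Pow_set_def by (rule the_set_mem[OF power_exists])

lemma mem_upair [simp]: "z \<epsilon> upair x y \<longleftrightarrow> z = x \<or> z = y"
  unfolding upair_def is_upair_def by (rule the_set_mem[OF is_upair_exists[unfolded is_upair_def]])

lemma mem_suc [simp]: "z \<epsilon> suc x \<longleftrightarrow> z \<epsilon> x \<or> z = x"
  unfolding suc_def by auto

lemma not_mem_zero [simp]: "\<not> x \<epsilon> zero"
proof -
  have "definable (\<lambda>_. False)" by (rule definable_const)
  then have "\<exists>b::'v. \<forall>x. x \<epsilon> b \<longleftrightarrow> False" using separation[of "\<lambda>_. False"] by blast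
  from the_set_mem[OF this] show ?thesis unfolding zero_def is_empty_def by simp
qed

lemma is_empty_iff [simp]: "is_empty x \<longleftrightarrow> x = zero"
  unfolding is_empty_def using not_mem_zero by (metis set_ext)

lemma is_upair_iff [simp]: "is_upair z x y \<longleftrightarrow> z = upair x y"
  unfolding is_upair_def by (metis mem_upair set_ext)

lemma is_succ_iff [simp]: "is_succ y x \<longleftrightarrow> y = suc x"
  unfolding is_succ_def by (metis mem_suc set_ext)

lemma is_opair_iff [simp]: "is_opair z x y \<longleftrightarrow> z = pair x y"
  unfolding is_opair_def pair_def by simp

lemma upair_eq_iff: "upair x y = upair u v \<longleftrightarrow> x = u \<and> y = v \<or> x = v \<and> y = u"
proof
  assume "upair x y = upair u v"
  then have "z = x \<or> z = y \<longleftrightarrow> z = u \<or> z = v" for z using mem_upair[of z x y] by simp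
  then show "x = u \<and> y = v \<or> x = v \<and> y = u" by metis
qed (auto intro: set_ext)

lemma pair_eq_iff [simp]: "pair x y = pair u v \<longleftrightarrow> x = u \<and> y = v"
  unfolding pair_def by (auto simp: upair_eq_iff)

lemma rel_iff: "rel r x y \<longleftrightarrow> pair x y \<epsilon> r"
  unfolding rel_def by simp

lemma definable_is_subset [definable_intro]:
  "definable_term t \<Longrightarrow> definable_term s \<Longrightarrow> definable (\<lambda>e. is_subset (t e) (s e))"
  by (rule definable2) (unfold is_subset_def, intro definable_intro)

lemma definable_term_Un_set [definable_intro]:
  "definable_term t \<Longrightarrow> definable_term (\<lambda>e. Un_set (t e))"
  by (rule definable_term1) (unfold Un_set_def, intro definable_intro)

lemma definable_term_Pow_set [definable_intro]:
  "definable_term t \<Longrightarrow> definable_term (\<lambda>e. Pow_set (t e))"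
  by (rule definable_term1) (unfold Pow_set_def, intro definable_intro)

lemma definable_term_upair [definable_intro]:
  "definable_term t \<Longrightarrow> definable_term s \<Longrightarrow> definable_term (\<lambda>e. upair (t e) (s e))"
  by (rule definable_term2) (unfold upair_def is_upair_def, intro definable_intro)

lemma definable_term_pair [definable_intro]:
  "definable_term t \<Longrightarrow> definable_term s \<Longrightarrow> definable_term (\<lambda>e. pair (t e) (s e))"
  by (rule definable_term2) (unfold pair_def, intro definable_intro)

lemma definable_term_suc [definable_intro]:
  "definable_term t \<Longrightarrow> definable_term (\<lambda>e. suc (t e))"
  by (rule definable_term1) (unfold suc_def, intro definable_intro)

lemma definable_term_ap [definable_intro]:
  "definable_term t \<Longrightarrow> definable_term s \<Longrightarrow> definable_term (\<lambda>e. ap (t e) (s e))"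
  by (rule definable_term2) (unfold ap_def, intro definable_intro)

lemma definable_rel [definable_intro]:
  "definable_term t \<Longrightarrow> definable_term s \<Longrightarrow> definable_term u \<Longrightarrow> definable (\<lambda>e. rel (t e) (s e) (u e))"
  unfolding rel_iff by (intro definable_intro)

lemma definable_term_sep [definable_intro]:
  assumes "definable_term t" "definable (\<lambda>e. Q (\<lambda>n. e (Suc n)) (e 0))"
  shows "definable_term (\<lambda>e. sep (t e) (Q e))"
  unfolding sep_def
  by (rule definable_term_subst[OF assms(1)])
    (use definable_rename[OF assms(2), of "case_nat 0 (\<lambda>n. Suc (Suc (Suc n)))"] in \<open>intro definable_intro, simp\<close>)

lemma definable_is_trans [definable_intro]:
  "definable_term t \<Longrightarrow> definable (\<lambda>e. is_trans (t e))"
  by (rule definable1) (unfold is_trans_def, intro definable_intro)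

lemma definable_is_ordinal [definable_intro]:
  "definable_term t \<Longrightarrow> definable (\<lambda>e. is_ordinal (t e))"
  by (rule definable1) (unfold is_ordinal_def, intro definable_intro)

lemma definable_is_fun [definable_intro]:
  "definable_term t \<Longrightarrow> definable_term s \<Longrightarrow> definable_term u \<Longrightarrow> definable (\<lambda>e. is_fun (t e) (s e) (u e))"
  by (rule definable3) (unfold is_fun_def is_opair_iff, intro definable_intro)

lemma is_subsetD: "is_subset a b \<Longrightarrow> x \<epsilon> a \<Longrightarrow> x \<epsilon> (b::'v)"
  by (simp add: is_subset_def)

lemma not_mem_self: "\<not> x \<epsilon> (x::'v)"
  using foundation[of x "upair x x"] by auto

lemma not_mem_cycle: "x \<epsilon> y \<Longrightarrow> \<not> y \<epsilon> (x::'v)"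
  using foundation[of x "upair x y"] by auto

section \<open>Ordinals\<close>

lemma ordinal_trans: "is_ordinal a \<Longrightarrow> x \<epsilon> a \<Longrightarrow> y \<epsilon> x \<Longrightarrow> y \<epsilon> (a::'v)"
  unfolding is_ordinal_def is_trans_def is_subset_def by blast

lemma ordinal_mem: "is_ordinal a \<Longrightarrow> x \<epsilon> a \<Longrightarrow> is_ordinal (x::'v)"
  unfolding is_ordinal_def is_trans_def is_subset_def by blast

lemma ordinal_suc: "is_ordinal a \<Longrightarrow> is_ordinal (suc a)"
  unfolding is_ordinal_def is_trans_def is_subset_def mem_suc by blast

text \<open>Foundation is applied to the set of counterexamples up to \<open>a\<close>. Separation
  has to form this set, hence the definability premise.\<close>

lemma ordinal_induct [consumes 1, case_names definable step]:
  assumes "is_ordinal a" "definable (\<lambda>e. Q (e 0))"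
    and step: "\<And>x. is_ordinal x \<Longrightarrow> (\<And>y. y \<epsilon> x \<Longrightarrow> Q y) \<Longrightarrow> Q x"
  shows "Q a"
proof (rule ccontr)
  assume "\<not> Q a"
  let ?b = "sep (suc a) (\<lambda>x. \<not> Q x)"
  have mem: "x \<epsilon> ?b \<longleftrightarrow> x \<epsilon> suc a \<and> \<not> Q x" for x
    by (rule mem_sep) (intro definable_intro assms(2))
  then have "a \<epsilon> ?b" using \<open>\<not> Q a\<close> by simp
  then obtain y where y: "y \<epsilon> ?b" "\<And>z. z \<epsilon> ?b \<Longrightarrow> \<not> z \<epsilon> y" using foundation by blast
  have "is_ordinal y" using y(1) ordinal_mem[OF ordinal_suc[OF assms(1)]] by (simp add: mem)
  then have "Q y"
    by (rule step) (use y ordinal_trans[OF ordinal_suc[OF assms(1)]] in \<open>auto simp: mem\<close>)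
  then show False using y(1) by (simp add: mem)
qed

text \<open>Double induction: if x and y were incomparable, every element of x would lie in y and
  every element of y in x, so x and y would be equal.\<close>

lemma ordinal_linear:
  assumes "is_ordinal (a::'v)" "is_ordinal b"
  shows "a \<epsilon> b \<or> a = b \<or> b \<epsilon> a"
proof -
  have "\<forall>b::'v. is_ordinal b \<longrightarrow> a \<epsilon> b \<or> a = b \<or> b \<epsilon> a"
    using assms(1)
  proof (induction a rule: ordinal_induct)
    show "definable (\<lambda>e. \<forall>b. is_ordinal b \<longrightarrow> e 0 \<epsilon> b \<or> e 0 = b \<or> b \<epsilon> e 0)"
      by (intro definable_intro)
  next
    case (step x)
    show ?case
    proof (intro allI impI)
      fix b :: 'v assume "is_ordinal b"
      then show "x \<epsilon> b \<or> x = b \<or> b \<epsilon> x"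
      proof (induction b rule: ordinal_induct)
        show "definable (\<lambda>e. x \<epsilon> e 0 \<or> x = e 0 \<or> e 0 \<epsilon> x)" by (intro definable_intro)
      next
        case (step y)
        note IHx = \<open>\<And>z. z \<epsilon> x \<Longrightarrow> \<forall>b. is_ordinal b \<longrightarrow> z \<epsilon> b \<or> z = b \<or> b \<epsilon> z\<close>
        show ?case
        proof (rule ccontr)
          assume "\<not> ?case"
          have "z \<epsilon> y" if "z \<epsilon> x" for z
            using IHx[OF that] \<open>\<not> ?case\<close> that ordinal_trans[OF \<open>is_ordinal x\<close>] \<open>is_ordinal y\<close> by blast
          moreover have "z \<epsilon> x" if "z \<epsilon> y" for z
            using step.IH[OF that] \<open>\<not> ?case\<close> that ordinal_trans[OF \<open>is_ordinal y\<close>] by blast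
          ultimately have "x = y" by (blast intro: set_ext)
          then show False using \<open>\<not> ?case\<close> by simp
        qed
      qed
    qed
  qed
  then show ?thesis using assms(2) by blast
qed

section \<open>Functions\<close>

definition cart :: "'v \<Rightarrow> 'v \<Rightarrow> 'v" where
  "cart a b = sep (Pow_set (Pow_set (Un_set (upair a b)))) (\<lambda>z. \<exists>x y. x \<epsilon> a \<and> y \<epsilon> b \<and> z = pair x y)"

definition lam :: "'v \<Rightarrow> ('v \<Rightarrow> 'v) \<Rightarrow> 'v" where
  "lam a G = image_set a (\<lambda>x. pair x (G x))"

definition restr :: "'v \<Rightarrow> 'v \<Rightarrow> 'v" where
  "restr f a = sep f (\<lambda>z. \<exists>x y. x \<epsilon> a \<and> z = pair x y)"

definition fun_on :: "'v \<Rightarrow> 'v \<Rightarrow> bool" where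
  "fun_on f a \<longleftrightarrow> (\<forall>z. z \<epsilon> f \<longrightarrow> (\<exists>x y. x \<epsilon> a \<and> z = pair x y)) \<and> (\<forall>x. x \<epsilon> a \<longrightarrow> (\<exists>!y. pair x y \<epsilon> f))"

definition funs :: "'v \<Rightarrow> 'v \<Rightarrow> 'v" where
  "funs a b = sep (Pow_set (cart a b)) (\<lambda>f. is_fun f a b)"

lemma mem_cart: "z \<epsilon> cart a b \<longleftrightarrow> (\<exists>x y. x \<epsilon> a \<and> y \<epsilon> b \<and> z = pair x y)"
proof -
  have "z \<epsilon> cart a b \<longleftrightarrow> z \<epsilon> Pow_set (Pow_set (Un_set (upair a b))) \<and> (\<exists>x y. x \<epsilon> a \<and> y \<epsilon> b \<and> z = pair x y)"
    unfolding cart_def by (rule mem_sep) (intro definable_intro)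
  moreover have "pair x y \<epsilon> Pow_set (Pow_set (Un_set (upair a b)))" if "x \<epsilon> a" "y \<epsilon> b" for x y
    using that by (auto simp: pair_def is_subset_def)
  ultimately show ?thesis by auto
qed

lemma mem_lam:
  assumes "definable_term (\<lambda>e. G (e 0))"
  shows "z \<epsilon> lam a G \<longleftrightarrow> (\<exists>x. x \<epsilon> a \<and> z = pair x (G x))"
  unfolding lam_def by (rule mem_image_set) (intro definable_intro assms)

lemma mem_restr: "z \<epsilon> restr f a \<longleftrightarrow> z \<epsilon> f \<and> (\<exists>x y. x \<epsilon> a \<and> z = pair x y)"
  unfolding restr_def by (rule mem_sep) (intro definable_intro)

lemma pair_mem_restr [simp]: "pair x y \<epsilon> restr f a \<longleftrightarrow> pair x y \<epsilon> f \<and> x \<epsilon> a"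
  by (auto simp: mem_restr)

lemma is_restriction_iff: "is_restriction r f a \<longleftrightarrow> r = restr f a"
  unfolding is_restriction_def is_opair_iff using mem_restr[of _ f a] by (auto intro: set_ext)

lemma definable_term_restr [definable_intro]:
  "definable_term t \<Longrightarrow> definable_term s \<Longrightarrow> definable_term (\<lambda>e. restr (t e) (s e))"
  by (rule definable_term2) (unfold restr_def, intro definable_intro)

lemma definable_fun_on [definable_intro]:
  "definable_term t \<Longrightarrow> definable_term s \<Longrightarrow> definable (\<lambda>e. fun_on (t e) (s e))"
  by (rule definable2) (unfold fun_on_def, intro definable_intro)

lemma fun_on_ap: "fun_on f a \<Longrightarrow> pair x y \<epsilon> f \<longleftrightarrow> x \<epsilon> a \<and> y = ap f x"
proof
  assume f: "fun_on f a" and xy: "pair x y \<epsilon> f"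
  then have "x \<epsilon> a" unfolding fun_on_def by fastforce
  then have "\<exists>!y. pair x y \<epsilon> f" using f unfolding fun_on_def by blast
  then show "x \<epsilon> a \<and> y = ap f x" using \<open>x \<epsilon> a\<close> xy the_setI[of "\<lambda>y. pair x y \<epsilon> f"] unfolding ap_def by blast
next
  assume f: "fun_on f a" and "x \<epsilon> a \<and> y = ap f x"
  then show "pair x y \<epsilon> f" unfolding fun_on_def ap_def using the_setI[of "\<lambda>y. pair x y \<epsilon> f"] by blast
qed

lemma fun_onE: "fun_on f a \<Longrightarrow> z \<epsilon> f \<Longrightarrow> (\<And>x. x \<epsilon> a \<Longrightarrow> z = pair x (ap f x) \<Longrightarrow> C) \<Longrightarrow> C"
  by (metis fun_on_ap fun_on_def)

lemma is_fun_iff: "is_fun f a b \<longleftrightarrow> fun_on f a \<and> (\<forall>x. x \<epsilon> a \<longrightarrow> ap f x \<epsilon> b)"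
proof
  assume "is_fun f a b"
  then have 1: "\<forall>z. z \<epsilon> f \<longrightarrow> (\<exists>x y. x \<epsilon> a \<and> y \<epsilon> b \<and> z = pair x y)"
    and 2: "\<forall>x. x \<epsilon> a \<longrightarrow> (\<exists>!y. pair x y \<epsilon> f)"
    unfolding is_fun_def rel_iff is_opair_iff by blast+
  then have f: "fun_on f a" unfolding fun_on_def by blast
  moreover have "ap f x \<epsilon> b" if "x \<epsilon> a" for x
  proof -
    have "pair x (ap f x) \<epsilon> f" using fun_on_ap[OF f] that by blast
    then show ?thesis using 1 by fastforce
  qed
  ultimately show "fun_on f a \<and> (\<forall>x. x \<epsilon> a \<longrightarrow> ap f x \<epsilon> b)" by blast
next
  assume f: "fun_on f a \<and> (\<forall>x. x \<epsilon> a \<longrightarrow> ap f x \<epsilon> b)"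
  then have "\<exists>x y. x \<epsilon> a \<and> y \<epsilon> b \<and> z = pair x y" if "z \<epsilon> f" for z
    using that by (blast elim: fun_onE)
  then show "is_fun f a b"
    using f unfolding is_fun_def rel_iff is_opair_iff fun_on_def by blast
qed

lemma fun_ext:
  assumes "fun_on f a" "fun_on g a" "\<And>x. x \<epsilon> a \<Longrightarrow> ap f x = ap g x"
  shows "f = g"
proof (rule set_ext)
  fix z show "z \<epsilon> f \<longleftrightarrow> z \<epsilon> g"
    using assms fun_on_ap[OF assms(1)] fun_on_ap[OF assms(2)] by (metis fun_onE)
qed

lemma fun_on_lam:
  assumes "definable_term (\<lambda>e. G (e 0))" shows "fun_on (lam a G) a"
  unfolding fun_on_def mem_lam[OF assms] by auto

lemma ap_lam: "definable_term (\<lambda>e. G (e 0)) \<Longrightarrow> x \<epsilon> a \<Longrightarrow> ap (lam a G) x = G x"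
  using fun_on_ap[OF fun_on_lam, of G x "G x" a] by (simp add: mem_lam)

lemma is_fun_lam:
  "definable_term (\<lambda>e. G (e 0)) \<Longrightarrow> (\<And>x. x \<epsilon> a \<Longrightarrow> G x \<epsilon> b) \<Longrightarrow> is_fun (lam a G) a b"
  by (simp add: is_fun_iff fun_on_lam ap_lam)

lemma fun_on_restr: "fun_on f a \<Longrightarrow> is_subset b a \<Longrightarrow> fun_on (restr f b) b"
  unfolding fun_on_def mem_restr is_subset_def by auto

lemma ap_restr: "x \<epsilon> b \<Longrightarrow> ap (restr f b) x = ap f x"
  by (simp add: ap_def)

lemma restr_restr: "is_subset b a \<Longrightarrow> restr (restr f a) b = restr f b"
  by (rule set_ext) (auto simp: mem_restr is_subset_def)

lemma mem_funs: "f \<epsilon> funs a b \<longleftrightarrow> is_fun f a b"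
proof -
  have "f \<epsilon> funs a b \<longleftrightarrow> f \<epsilon> Pow_set (cart a b) \<and> is_fun f a b"
    unfolding funs_def by (rule mem_sep) (intro definable_intro)
  moreover have "f \<epsilon> Pow_set (cart a b)" if "is_fun f a b"
    using that unfolding is_fun_def by (auto simp: is_subset_def mem_cart)
  ultimately show ?thesis by blast
qed

section \<open>Transfinite recursion\<close>

definition recursive_on :: "('v \<Rightarrow> 'v \<Rightarrow> 'v) \<Rightarrow> 'v \<Rightarrow> 'v \<Rightarrow> bool" where
  "recursive_on G d f \<longleftrightarrow> fun_on f d \<and> (\<forall>x. x \<epsilon> d \<longrightarrow> ap f x = G x (restr f x))"

lemma recursive_on_restr:
  assumes "is_ordinal d" "recursive_on G d f" "x \<epsilon> d"
  shows "recursive_on G x (restr f x)"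
proof -
  have sub: "is_subset x d" using assms ordinal_trans unfolding is_subset_def by blast
  have "is_subset y x" if "y \<epsilon> x" for y
    using that assms ordinal_trans[OF ordinal_mem] unfolding is_subset_def by blast
  then show ?thesis
    using assms(2) sub is_subsetD[OF sub] unfolding recursive_on_def
    by (auto simp: fun_on_restr ap_restr restr_restr)
qed

lemma recursive_on_unique:
  assumes "is_ordinal d" "recursive_on G d f" "recursive_on G d g"
  shows "f = g"
proof (rule fun_ext)
  show f: "fun_on f d" and g: "fun_on g d" using assms unfolding recursive_on_def by blast+
  fix x assume "x \<epsilon> d"
  then have "is_ordinal x" using assms(1) ordinal_mem by blast
  then have "x \<epsilon> d \<longrightarrow> ap f x = ap g x"
  proof (induction x rule: ordinal_induct)
    case definable show ?case by (intro definable_intro)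
  next
    case (step x)
    show ?case
    proof
      assume x: "x \<epsilon> d"
      then have sub: "is_subset x d" using assms ordinal_trans unfolding is_subset_def by blast
      have "restr f x = restr g x"
        by (rule fun_ext[OF fun_on_restr[OF f sub] fun_on_restr[OF g sub]])
          (use step.IH sub in \<open>auto simp: ap_restr is_subset_def\<close>)
      then show "ap f x = ap g x" using assms x unfolding recursive_on_def by simp
    qed
  qed
  then show "ap f x = ap g x" using \<open>x \<epsilon> d\<close> by blast
qed

text \<open>Induction on the length. The shorter solutions \<open>F x\<close> are unique, hence
  given by a definable class function, and Replacement collects the values \<open>G x (F x)\<close>
  into a solution on d. It is coherent because the restriction of \<open>F x\<close> to a smaller y
  is again a solution and so equals \<open>F y\<close>.\<close>

lemma recursion:
  assumes G: "definable_term (\<lambda>e. G (e 0) (e 1))" and "is_ordinal d"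
  shows "\<exists>f. recursive_on G d f"
  using assms(2)
proof (induction d rule: ordinal_induct)
  case definable show ?case unfolding recursive_on_def by (intro definable_intro definable_term2[OF G])
next
  case (step d)
  define F where "F x = the_set (recursive_on G x)" for x
  have F: "recursive_on G x (F x)" if "x \<epsilon> d" for x
  proof -
    have "\<exists>!f. recursive_on G x f"
      using step.IH[OF that] recursive_on_unique[OF ordinal_mem[OF step.hyps that]] by blast
    then show ?thesis unfolding F_def by (rule the_setI)
  qed
  have "definable_term (\<lambda>e. F (e 0))"
    unfolding F_def recursive_on_def by (intro definable_intro definable_term2[OF G])
  then have H: "definable_term (\<lambda>e. G (e 0) (F (e 0)))"
    by (intro definable_term2[OF G] definable_term_var)
  let ?f = "lam d (\<lambda>x. G x (F x))"
  have f: "fun_on ?f d" by (rule fun_on_lam[OF H])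
  have ap_f: "ap ?f x = G x (F x)" if "x \<epsilon> d" for x by (rule ap_lam[OF H that])
  have "restr ?f x = F x" if x: "x \<epsilon> d" for x
  proof (rule fun_ext)
    have sub: "is_subset x d" using x step.hyps ordinal_trans unfolding is_subset_def by blast
    then show "fun_on (restr ?f x) x" using f by (simp add: fun_on_restr)
    show "fun_on (F x) x" using F[OF x] unfolding recursive_on_def by blast
    fix y assume y: "y \<epsilon> x"
    then have yd: "y \<epsilon> d" using sub by (simp add: is_subset_def)
    have "restr (F x) y = F y"
      using recursive_on_unique[OF ordinal_mem[OF step.hyps yd]
          recursive_on_restr[OF ordinal_mem[OF step.hyps x] F[OF x] y] F[OF yd]] .
    then show "ap (restr ?f x) y = ap (F x) y"
      using F[OF x] y by (simp add: ap_restr ap_f[OF yd] recursive_on_def)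
  qed
  then have "recursive_on G d ?f" unfolding recursive_on_def using f ap_f by simp
  then show ?case by blast
qed

section \<open>Choice functions, bijections and enumeration along an ordinal\<close>

text \<open>The axiom of choice is stated for pairwise disjoint families. Replacing each nonempty
  subset X of A by {X} \<times> X makes the family disjoint, and the choice set then contains
  exactly one pair with first component X and second component in X.\<close>

lemma choice_function: "\<exists>c. \<forall>X. is_subset X A \<and> X \<noteq> zero \<longrightarrow> ap c X \<epsilon> X"
proof -
  let ?N = "sep (Pow_set A) (\<lambda>X. X \<noteq> zero)"
  have N: "X \<epsilon> ?N \<longleftrightarrow> is_subset X A \<and> X \<noteq> zero" for X
    using mem_sep[of "\<lambda>X. X \<noteq> zero"] by (simp add: definable_intro)
  have D: "definable_term (\<lambda>e. cart (upair (e 0) (e 0)) (e 0))"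
    unfolding cart_def by (intro definable_intro)
  let ?a = "image_set ?N (\<lambda>X. cart (upair X X) X)"
  have a: "x \<epsilon> ?a \<longleftrightarrow> (\<exists>X. X \<epsilon> ?N \<and> x = cart (upair X X) X)" for x
    by (rule mem_image_set[OF D])
  have "\<exists>c. \<forall>x. x \<epsilon> ?a \<longrightarrow> (\<exists>!z. z \<epsilon> x \<and> z \<epsilon> c)"
  proof (rule choice_set)
    fix x assume "x \<epsilon> ?a"
    then obtain X where "X \<noteq> zero" "x = cart (upair X X) X" unfolding a N by blast
    moreover obtain y where "y \<epsilon> X" using \<open>X \<noteq> zero\<close> is_empty_iff is_empty_def by blast
    ultimately show "\<exists>z. z \<epsilon> x" by (auto simp: mem_cart)
  next
    fix x y z assume "x \<epsilon> ?a" "y \<epsilon> ?a" "z \<epsilon> x" "z \<epsilon> y"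
    then show "x = y" unfolding a by (auto simp: mem_cart)
  qed
  then obtain c where c: "\<And>x. x \<epsilon> ?a \<Longrightarrow> \<exists>!z. z \<epsilon> x \<and> z \<epsilon> c" by blast
  let ?H = "\<lambda>X. the_set (\<lambda>y. y \<epsilon> X \<and> pair X y \<epsilon> c)"
  have H: "definable_term (\<lambda>e. ?H (e 0))" by (intro definable_intro)
  have "ap (lam (Pow_set A) ?H) X \<epsilon> X" if X: "is_subset X A \<and> X \<noteq> zero" for X
  proof -
    have "cart (upair X X) X \<epsilon> ?a" using X N a by blast
    from c[OF this] obtain z where z: "z \<epsilon> cart (upair X X) X" "z \<epsilon> c"
      and uniq: "\<And>w. w \<epsilon> cart (upair X X) X \<Longrightarrow> w \<epsilon> c \<Longrightarrow> w = z" by blast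
    from z(1) obtain y where y: "y \<epsilon> X" "z = pair X y" by (auto simp: mem_cart)
    have "\<exists>!y. y \<epsilon> X \<and> pair X y \<epsilon> c"
    proof (rule ex1I[of _ y])
      show "y \<epsilon> X \<and> pair X y \<epsilon> c" using y z by blast
      fix w assume "w \<epsilon> X \<and> pair X w \<epsilon> c"
      then show "w = y" using uniq[of "pair X w"] y by (simp add: mem_cart)
    qed
    then have "?H X \<epsilon> X" using the_setI[of "\<lambda>y. y \<epsilon> X \<and> pair X y \<epsilon> c"] by blast
    then show ?thesis using X by (simp add: ap_lam[OF H])
  qed
  then show ?thesis by blast
qed

lemma is_bij_iff:
  "is_bij f a b \<longleftrightarrow> fun_on f a \<and> (\<forall>x. x \<epsilon> a \<longrightarrow> ap f x \<epsilon> b) \<and>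
    (\<forall>y. y \<epsilon> b \<longrightarrow> (\<exists>x. x \<epsilon> a \<and> ap f x = y)) \<and>
    (\<forall>x y. x \<epsilon> a \<and> y \<epsilon> a \<and> ap f x = ap f y \<longrightarrow> x = y)"
  (is "?L \<longleftrightarrow> ?R")
proof (cases "fun_on f a")
  case True
  then show ?thesis unfolding is_bij_def is_fun_iff rel_iff fun_on_ap[OF True] by blast
qed (simp add: is_bij_def is_fun_iff)

abbreviation two :: 'v where "two \<equiv> suc (suc zero)"

lemma is_two_iff: "is_two t \<longleftrightarrow> t = two"
  unfolding is_two_def by simp

lemma funs_eqI: "(\<And>f. f \<epsilon> F \<longleftrightarrow> is_fun f a b) \<Longrightarrow> F = funs a b"
  by (rule set_ext) (simp add: mem_funs)

lemma ordinal_zero: "is_ordinal zero"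
  unfolding is_ordinal_def is_trans_def is_subset_def by simp

lemma ordinal_subset: "is_ordinal a \<Longrightarrow> x \<epsilon> a \<Longrightarrow> is_subset x (a::'v)"
  unfolding is_subset_def using ordinal_trans by blast

text \<open>Enumerate \<open>A\<close> along \<open>d\<close> without repetition until it is exhausted.\<close>

lemma enumerate:
  assumes d: "is_ordinal d"
  shows "(\<exists>f. is_fun f d A \<and> (\<forall>x y. x \<epsilon> d \<and> y \<epsilon> d \<and> ap f x = ap f y \<longrightarrow> x = y)) \<or>
    (\<exists>x f. x \<epsilon> d \<and> is_bij f x A)"
proof -
  obtain c where c: "\<And>X. is_subset X A \<Longrightarrow> X \<noteq> zero \<Longrightarrow> ap c X \<epsilon> X"
    using choice_function[of A] by blast
  define rest where "rest f = sep A (\<lambda>g. \<forall>y. \<not> pair y g \<epsilon> f)" for f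
  have mem_rest: "g \<epsilon> rest f \<longleftrightarrow> g \<epsilon> A \<and> (\<forall>y. \<not> pair y g \<epsilon> f)" for g f
    unfolding rest_def by (rule mem_sep) (intro definable_intro)
  have D: "definable_term (\<lambda>e. rest (e n))" for n
    unfolding rest_def by (intro definable_intro)
  have "definable_term (\<lambda>e. ap c (rest (e 1)))" by (intro definable_intro D)
  then obtain f where f: "recursive_on (\<lambda>x f. ap c (rest f)) d f"
    using recursion[of "\<lambda>x f. ap c (rest f)" d] d by blast
  have fun_f: "fun_on f d" and ap_f: "\<And>x. x \<epsilon> d \<Longrightarrow> ap f x = ap c (rest (restr f x))"
    using f unfolding recursive_on_def by auto
  have mem_rest_restr: "g \<epsilon> rest (restr f x) \<longleftrightarrow> g \<epsilon> A \<and> (\<forall>y. y \<epsilon> x \<longrightarrow> g \<noteq> ap f y)" if "x \<epsilon> d" for g x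
    using that fun_on_ap[OF fun_f] ordinal_trans[OF d that] unfolding mem_rest pair_mem_restr by blast
  have new: "ap f x \<epsilon> A \<and> (\<forall>y. y \<epsilon> x \<longrightarrow> ap f x \<noteq> ap f y)" if "x \<epsilon> d" "rest (restr f x) \<noteq> zero" for x
  proof -
    have "is_subset (rest (restr f x)) A" unfolding is_subset_def mem_rest by blast
    from c[OF this that(2)] show ?thesis unfolding mem_rest_restr[OF that(1)] ap_f[OF that(1)] .
  qed
  have inj: "x = y" if "x \<epsilon> d" "y \<epsilon> d" "ap f x = ap f y" "rest (restr f x) \<noteq> zero" "rest (restr f y) \<noteq> zero" for x y
    using ordinal_linear[OF ordinal_mem[OF d that(1)] ordinal_mem[OF d that(2)]] new[OF that(1,4)] new[OF that(2,5)] that(3)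
    by metis
  show ?thesis
  proof (cases "\<forall>x. x \<epsilon> d \<longrightarrow> rest (restr f x) \<noteq> zero")
    case True
    then have "is_fun f d A" unfolding is_fun_iff using fun_f new by blast
    then show ?thesis using inj True by blast
  next
    case False
    \<comment> \<open>A minimal stage with nothing left is taken. All earlier stages pick new
      elements of \<open>A\<close>, so the enumeration up to this stage is injective, and it is onto
      because the remainder is empty.\<close>
    let ?S = "sep d (\<lambda>x. rest (restr f x) = zero)"
    have S: "x \<epsilon> ?S \<longleftrightarrow> x \<epsilon> d \<and> rest (restr f x) = zero" for x
      by (rule mem_sep) (intro definable_intro definable_term1[OF D])
    obtain x where x: "x \<epsilon> ?S" "\<And>z. z \<epsilon> ?S \<Longrightarrow> \<not> z \<epsilon> x" using False foundation S by blast
    then have xd: "x \<epsilon> d" and rx: "rest (restr f x) = zero" using S by blast+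
    have xs: "y \<epsilon> d \<and> rest (restr f y) \<noteq> zero" if "y \<epsilon> x" for y
      using that x(2) S ordinal_trans[OF d xd] by blast
    have "is_bij (restr f x) x A"
      unfolding is_bij_iff
    proof (intro conjI allI impI)
      show "fun_on (restr f x) x" by (rule fun_on_restr[OF fun_f ordinal_subset[OF d xd]])
      show "ap (restr f x) y \<epsilon> A" if "y \<epsilon> x" for y using new xs[OF that] that by (simp add: ap_restr)
      show "\<exists>y. y \<epsilon> x \<and> ap (restr f x) y = g" if "g \<epsilon> A" for g
        using mem_rest_restr[OF xd, of g] that rx by (auto simp: ap_restr)
      show "y = z" if "y \<epsilon> x \<and> z \<epsilon> x \<and> ap (restr f x) y = ap (restr f x) z" for y z
      proof (rule inj)
        show "ap f y = ap f z" using that ap_restr[of y x f] ap_restr[of z x f] by simp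
      qed (use that xs in blast)+
    qed
    then show ?thesis using xd by blast
  qed
qed

lemma suc_inject: "suc x = suc y \<Longrightarrow> x = y"
  using mem_suc[of x x] mem_suc[of x y] mem_suc[of y x] mem_suc[of y y] not_mem_cycle[of x y] by auto

lemma suc_mem_suc: "is_ordinal a \<Longrightarrow> x \<epsilon> a \<Longrightarrow> suc x \<epsilon> suc a"
  using ordinal_linear[of "suc x" a] ordinal_suc[OF ordinal_mem, of a x] not_mem_cycle[of x a] not_mem_self[of a]
  by auto

section \<open>Stages of the game\<close>

text \<open>This is the condition that \<open>stage_of_I\<close> puts on its witness. It is kept
  apart because existence and uniqueness of markings yield the recursive description of the stages
  of I, both in V and in \<open>M\<close>.\<close>

definition stage_marking :: "'v \<Rightarrow> 'v \<Rightarrow> bool" where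
  "stage_marking s m \<longleftrightarrow> (\<forall>t. t \<epsilon> s \<or> t = s \<longrightarrow> (t \<epsilon> m \<longleftrightarrow> t = zero \<or> (\<exists>u. t = suc u \<and> \<not> u \<epsilon> m)))"

lemma stage_of_I_iff: "stage_of_I s \<longleftrightarrow> (\<exists>m. s \<epsilon> m \<and> stage_marking s m)"
  unfolding stage_of_I_def stage_marking_def by simp

lemma definable_stage_of_I [definable_intro]:
  "definable_term t \<Longrightarrow> definable (\<lambda>e. stage_of_I (t e))"
  by (rule definable1) (unfold stage_of_I_iff stage_marking_def, intro definable_intro)

lemma stage_marking_mem:
  "is_ordinal s \<Longrightarrow> stage_marking s m \<Longrightarrow> t \<epsilon> s \<Longrightarrow> stage_marking t m"
  unfolding stage_marking_def using ordinal_trans by blast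

text \<open>The status of a successor is determined by that of its predecessor, while zero and
  limits have a fixed status. Agreement is claimed only at \<open>s\<close>, since a marking may
  contain anything beyond its stages.\<close>

lemma stage_marking_unique:
  assumes "is_ordinal s" "stage_marking s m" "stage_marking s n"
  shows "s \<epsilon> m \<longleftrightarrow> s \<epsilon> n"
proof -
  have "stage_marking s m \<and> stage_marking s n \<longrightarrow> (s \<epsilon> m \<longleftrightarrow> s \<epsilon> n)"
    using assms(1)
  proof (induction s rule: ordinal_induct)
    case definable show ?case unfolding stage_marking_def by (intro definable_intro)
  next
    case (step s)
    show ?case
    proof
      assume *: "stage_marking s m \<and> stage_marking s n"
      then have "u \<epsilon> m \<longleftrightarrow> u \<epsilon> n" if "s = suc u" for u
        using step that stage_marking_mem[of s _ u] by simp
      moreover have "s \<epsilon> m \<longleftrightarrow> s = zero \<or> (\<exists>u. s = suc u \<and> \<not> u \<epsilon> m)"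
        "s \<epsilon> n \<longleftrightarrow> s = zero \<or> (\<exists>u. s = suc u \<and> \<not> u \<epsilon> n)"
        using * unfolding stage_marking_def by blast+
      ultimately show "s \<epsilon> m \<longleftrightarrow> s \<epsilon> n" by metis
    qed
  qed
  then show ?thesis using assms by blast
qed

text \<open>By induction the stages below s are already decided by \<open>stage_of_I\<close>.
  Collecting those that belong to I and deciding s itself by the recursive clause gives a
  marking.\<close>

lemma stage_marking_exists: "is_ordinal s \<Longrightarrow> \<exists>m. stage_marking s m"
proof (induction s rule: ordinal_induct)
  case definable show ?case unfolding stage_marking_def by (intro definable_intro)
next
  case (step s)
  let ?C = "\<lambda>t. t \<epsilon> s \<and> stage_of_I t \<or> t = s \<and> (s = zero \<or> (\<exists>u. s = suc u \<and> \<not> stage_of_I u))"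
  let ?m = "sep (suc s) ?C"
  have m: "t \<epsilon> ?m \<longleftrightarrow> t \<epsilon> suc s \<and> ?C t" for t
    by (rule mem_sep) (intro definable_intro)
  have mem_m: "t \<epsilon> ?m \<longleftrightarrow> stage_of_I t" if "t \<epsilon> s" for t
    using that not_mem_self[of s] by (auto simp: m)
  \<comment> \<open>A single marking up to t decides both t and its predecessor, so its clause at t
    becomes the clause for \<open>stage_of_I\<close>.\<close>
  have stage: "stage_of_I t \<longleftrightarrow> t = zero \<or> (\<exists>u. t = suc u \<and> \<not> stage_of_I u)" if t: "t \<epsilon> s" for t
  proof -
    obtain n where n: "stage_marking t n" using step.IH[OF t] by blast
    have eq: "stage_of_I u \<longleftrightarrow> u \<epsilon> n" if "u = t \<or> u \<epsilon> t" for u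
    proof -
      have "is_ordinal u" "stage_marking u n"
        using that t n stage_marking_mem ordinal_mem[OF step.hyps] ordinal_mem by blast+
      then show ?thesis unfolding stage_of_I_iff using stage_marking_unique by blast
    qed
    have "t \<epsilon> n \<longleftrightarrow> t = zero \<or> (\<exists>u. t = suc u \<and> \<not> u \<epsilon> n)"
      using n unfolding stage_marking_def by blast
    then show ?thesis using eq by auto
  qed
  have "t \<epsilon> ?m \<longleftrightarrow> t = zero \<or> (\<exists>u. t = suc u \<and> \<not> u \<epsilon> ?m)" if "t \<epsilon> s \<or> t = s" for t
  proof -
    have "u \<epsilon> ?m \<longleftrightarrow> stage_of_I u" if "t = suc u" for u
      using mem_m[of u] \<open>t \<epsilon> s \<or> t = s\<close> that ordinal_trans[OF step.hyps, of t u] by auto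
    moreover have "t \<epsilon> ?m \<longleftrightarrow> t = zero \<or> (\<exists>u. t = suc u \<and> \<not> stage_of_I u)"
      using that mem_m[of t] stage[of t] not_mem_self[of s] by (auto simp: m)
    ultimately show ?thesis by blast
  qed
  then have "stage_marking s ?m" unfolding stage_marking_def by blast
  then show ?case by blast
qed

lemma stage_of_I_marking:
  "is_ordinal s \<Longrightarrow> stage_marking s m \<Longrightarrow> stage_of_I s \<longleftrightarrow> s \<epsilon> m"
  unfolding stage_of_I_iff using stage_marking_unique by blast

lemma stage_of_I_cases:
  assumes "is_ordinal s"
  shows "stage_of_I s \<longleftrightarrow> s = zero \<or> (\<exists>u. s = suc u \<and> \<not> stage_of_I u)"
proof -
  obtain m where m: "stage_marking s m" using stage_marking_exists[OF assms] by blast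
  have "stage_of_I u \<longleftrightarrow> u \<epsilon> m" if "s = suc u" for u
    using stage_of_I_marking[of u m] stage_marking_mem[OF assms m, of u] ordinal_mem[OF assms, of u] that
    by simp
  moreover have "s \<epsilon> m \<longleftrightarrow> s = zero \<or> (\<exists>u. s = suc u \<and> \<not> u \<epsilon> m)"
    using m unfolding stage_marking_def by blast
  ultimately show ?thesis using stage_of_I_marking[OF assms m] by blast
qed

end

section \<open>Transfer along the embedding\<close>

locale embedding = zfc_structure M j for M :: "'v::set_structure set" and j +
  assumes transitive: "transitive_class M" and elementary: "elementary_embedding j M"
begin

lemma M_mem: "x \<in> M \<Longrightarrow> y \<epsilon> x \<Longrightarrow> y \<in> M"
  using transitive unfolding transitive_class_def by blast

lemma j_in_M [simp]: "j x \<in> M"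
  using elementary unfolding elementary_embedding_def by blast

text \<open>Quantifiers become bounded by \<open>M\<close>, and every parameter \<open>a\<close> becomes \<open>j a\<close>.\<close>

definition transfers :: "((nat \<Rightarrow> 'v) \<Rightarrow> bool) \<Rightarrow> ((nat \<Rightarrow> 'v) \<Rightarrow> bool) \<Rightarrow> bool" where
  "transfers Q Q' \<longleftrightarrow> (\<exists>\<phi> c. pure_fm \<phi> \<and> (\<forall>e. sat UNIV M j \<phi> (join c e) = Q e) \<and>
    (\<forall>e. (\<forall>n. e n \<in> M) \<longrightarrow> sat M M j \<phi> (join (\<lambda>n. j (c n)) e) = Q' e))"

text \<open>The image term is required to take values in \<open>M\<close>, so that it can
  instantiate quantifiers bounded by \<open>M\<close>.\<close>

definition transfers_term :: "((nat \<Rightarrow> 'v) \<Rightarrow> 'v) \<Rightarrow> ((nat \<Rightarrow> 'v) \<Rightarrow> 'v) \<Rightarrow> bool" where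
  "transfers_term t t' \<longleftrightarrow>
    transfers (\<lambda>e. e 0 = t (\<lambda>n. e (Suc n))) (\<lambda>e. e 0 = t' (\<lambda>n. e (Suc n))) \<and>
    (\<forall>e. (\<forall>n. e n \<in> M) \<longrightarrow> t' e \<in> M)"

lemma transfersI:
  assumes "pure_fm \<phi>" "\<And>e. sat UNIV M j \<phi> (join c e) = Q e"
    and "\<And>e. (\<forall>n. e n \<in> M) \<Longrightarrow> sat M M j \<phi> (join (\<lambda>n. j (c n)) e) = Q' e"
  shows "transfers Q Q'"
  unfolding transfers_def using assms by blast

lemma transfersE:
  assumes "transfers Q Q'"
  obtains \<phi> c where "pure_fm \<phi>" "\<And>e. sat UNIV M j \<phi> (join c e) = Q e"
    "\<And>e. (\<forall>n. e n \<in> M) \<Longrightarrow> sat M M j \<phi> (join (\<lambda>n. j (c n)) e) = Q' e"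
  using assms unfolding transfers_def by blast

text \<open>Elementarity for sentences with parameters. The variables may hold anything, so they are
  filled with the parameters \<open>c\<close>, whose images under \<open>j\<close> lie in
  \<open>M\<close>.\<close>

lemma transfer:
  assumes "transfers (\<lambda>_. A) (\<lambda>_. B)" shows "A \<longleftrightarrow> B"
proof -
  obtain \<phi> c where \<phi>: "pure_fm \<phi>" "\<And>e. sat UNIV M j \<phi> (join c e) = A"
    "\<And>e. (\<forall>n. e n \<in> M) \<Longrightarrow> sat M M j \<phi> (join (\<lambda>n. j (c n)) e) = B"
    using assms by (rule transfersE) (rule that)
  have "j \<circ> join c c = join (\<lambda>n. j (c n)) (\<lambda>n. j (c n))"
    using join_map[of j c c] by (simp add: comp_def)
  moreover have "sat UNIV M j \<phi> (join c c) \<longleftrightarrow> sat M M j \<phi> (j \<circ> join c c)"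
    using elementary \<phi>(1) unfolding elementary_embedding_def by blast
  ultimately show ?thesis using \<phi>(2)[of c] \<phi>(3)[of "\<lambda>n. j (c n)"] by (simp add: image_subset_iff)
qed

lemma transferD: "A \<Longrightarrow> transfers (\<lambda>_. A) (\<lambda>_. B) \<Longrightarrow> B"
  using transfer by blast

text \<open>This is where absoluteness enters: the relativised side may be replaced by anything
  equivalent to it on environments in \<open>M\<close>.\<close>

lemma transfers_cong:
  "transfers Q Q' \<Longrightarrow> (\<And>e. (\<forall>n. e n \<in> M) \<Longrightarrow> Q' e = Q'' e) \<Longrightarrow> transfers Q Q''"
  unfolding transfers_def by (elim exE, intro exI) auto

lemma transfers_cong_both:
  "transfers Q Q' \<Longrightarrow> (\<And>e. Q e = S e) \<Longrightarrow> (\<And>e. (\<forall>n. e n \<in> M) \<Longrightarrow> Q' e = S' e) \<Longrightarrow> transfers S S'"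
  unfolding transfers_def by (elim exE, intro exI) auto

lemma transfers_rename:
  "transfers Q Q' \<Longrightarrow> transfers (\<lambda>e. Q (\<lambda>n. e (r n))) (\<lambda>e. Q' (\<lambda>n. e (r n)))"
  by (elim transfersE, rule_tac \<phi> = "rename_fm (ren_vars r) \<phi>" and c = c in transfersI)
    (auto simp: sat_rename_fm simp flip: join_ren_vars)

lemma transfers_not: "transfers Q Q' \<Longrightarrow> transfers (\<lambda>e. \<not> Q e) (\<lambda>e. \<not> Q' e)"
  by (elim transfersE, rule_tac \<phi> = "Neg \<phi>" and c = c in transfersI) auto

lemma transfers_conj:
  assumes "transfers Q Q'" "transfers S S'"
  shows "transfers (\<lambda>e. Q e \<and> S e) (\<lambda>e. Q' e \<and> S' e)"
proof -
  obtain \<phi> c where \<phi>: "pure_fm \<phi>" "\<And>e. sat UNIV M j \<phi> (join c e) = Q e"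
    "\<And>e. (\<forall>n. e n \<in> M) \<Longrightarrow> sat M M j \<phi> (join (\<lambda>n. j (c n)) e) = Q' e"
    using assms(1) by (rule transfersE) (rule that)
  obtain \<psi> d where \<psi>: "pure_fm \<psi>" "\<And>e. sat UNIV M j \<psi> (join d e) = S e"
    "\<And>e. (\<forall>n. e n \<in> M) \<Longrightarrow> sat M M j \<psi> (join (\<lambda>n. j (d n)) e) = S' e"
    using assms(2) by (rule transfersE) (rule that)
  show ?thesis
    by (rule transfersI[where \<phi> = "Conj (rename_fm ren_left \<phi>) (rename_fm ren_right \<psi>)" and c = "join d c"])
      (use \<phi> \<psi> in \<open>simp_all add: sat_rename_fm join_map flip: join_left join_right\<close>)
qed

lemma transfers_all:
  assumes "transfers (\<lambda>e. Q (e 0) (\<lambda>n. e (Suc n))) (\<lambda>e. Q' (e 0) (\<lambda>n. e (Suc n)))"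
  shows "transfers (\<lambda>e. \<forall>x. Q x e) (\<lambda>e. \<forall>x\<in>M. Q' x e)"
proof -
  obtain \<phi> c where \<phi>: "pure_fm \<phi>" "\<And>e. sat UNIV M j \<phi> (join c e) = Q (e 0) (\<lambda>n. e (Suc n))"
    "\<And>e. (\<forall>n. e n \<in> M) \<Longrightarrow> sat M M j \<phi> (join (\<lambda>n. j (c n)) e) = Q' (e 0) (\<lambda>n. e (Suc n))"
    using assms by (rule transfersE) (rule that)
  have "sat UNIV M j (rename_fm swap_var \<phi>) (case_nat x (join c e)) = Q x e" for x e
    using \<phi>(2)[of "case_nat x e"] by (simp add: sat_rename_fm flip: join_case_nat)
  moreover have "sat M M j (rename_fm swap_var \<phi>) (case_nat x (join (\<lambda>n. j (c n)) e)) = Q' x e"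
    if "x \<in> M" "(\<forall>n. e n \<in> M)" for x e
  proof -
    have "\<forall>n. case_nat x e n \<in> M" using that by (auto split: nat.splits)
    then show ?thesis
      using \<phi>(3)[of "case_nat x e"] by (simp add: sat_rename_fm flip: join_case_nat)
  qed
  ultimately show ?thesis
    by (intro transfersI[where \<phi> = "Forall (rename_fm swap_var \<phi>)" and c = c]) (simp_all add: \<phi>(1))
qed

lemma transfers_imp:
  "transfers Q Q' \<Longrightarrow> transfers S S' \<Longrightarrow> transfers (\<lambda>e. Q e \<longrightarrow> S e) (\<lambda>e. Q' e \<longrightarrow> S' e)"
  using transfers_not[OF transfers_conj[OF _ transfers_not, of Q Q' S S']] by simp

lemma transfers_disj:
  "transfers Q Q' \<Longrightarrow> transfers S S' \<Longrightarrow> transfers (\<lambda>e. Q e \<or> S e) (\<lambda>e. Q' e \<or> S' e)"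
  using transfers_imp[OF transfers_not, of Q Q' S S'] by (simp add: disj_imp)

lemma transfers_iff:
  "transfers Q Q' \<Longrightarrow> transfers S S' \<Longrightarrow> transfers (\<lambda>e. Q e \<longleftrightarrow> S e) (\<lambda>e. Q' e \<longleftrightarrow> S' e)"
  using transfers_conj[OF transfers_imp transfers_imp, of Q Q' S S' S S' Q Q']
  by (simp add: iff_conv_conj_imp)

lemma transfers_ex:
  "transfers (\<lambda>e. Q (e 0) (\<lambda>n. e (Suc n))) (\<lambda>e. Q' (e 0) (\<lambda>n. e (Suc n)))
    \<Longrightarrow> transfers (\<lambda>e. \<exists>x. Q x e) (\<lambda>e. \<exists>x\<in>M. Q' x e)"
  using transfers_not[OF transfers_all[OF transfers_not], of Q Q'] by simp

lemma transfers_subst: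
  assumes "transfers_term t t'"
    and "transfers (\<lambda>e. Q (e 0) (\<lambda>n. e (Suc n))) (\<lambda>e. Q' (e 0) (\<lambda>n. e (Suc n)))"
  shows "transfers (\<lambda>e. Q (t e) e) (\<lambda>e. Q' (t' e) e)"
proof -
  have "transfers (\<lambda>e. \<exists>x. x = t e \<and> Q x e) (\<lambda>e. \<exists>x\<in>M. x = t' e \<and> Q' x e)"
    by (intro transfers_ex transfers_conj assms(2)) (use assms(1) in \<open>simp add: transfers_term_def\<close>)
  then have "transfers (\<lambda>e. Q (t e) e) (\<lambda>e. \<exists>x\<in>M. x = t' e \<and> Q' x e)" by simp
  then show ?thesis
    by (rule transfers_cong) (use assms(1) in \<open>auto simp: transfers_term_def\<close>)
qed

lemma transfers_term_rename:
  assumes "transfers_term t t'"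
  shows "transfers_term (\<lambda>e. t (\<lambda>n. e (r n))) (\<lambda>e. t' (\<lambda>n. e (r n)))"
  unfolding transfers_term_def
proof
  show "transfers (\<lambda>e. e 0 = t (\<lambda>n. e (Suc (r n)))) (\<lambda>e. e 0 = t' (\<lambda>n. e (Suc (r n))))"
    using transfers_rename[of _ _ "case_nat 0 (\<lambda>n. Suc (r n))", OF conjunct1[OF assms[unfolded transfers_term_def]]]
    by simp
  show "\<forall>e. (\<forall>n. e n \<in> M) \<longrightarrow> t' (\<lambda>n. e (r n)) \<in> M"
    using assms unfolding transfers_term_def by (simp add: image_subset_iff)
qed

lemma transfers1:
  assumes "transfers (\<lambda>e. N (e 0)) (\<lambda>e. N' (e 0))" "transfers_term t t'"
  shows "transfers (\<lambda>e. N (t e)) (\<lambda>e. N' (t' e))"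
  by (rule transfers_subst[OF assms(2,1)])

lemma transfers2:
  assumes "transfers (\<lambda>e. N (e 0) (e 1)) (\<lambda>e. N' (e 0) (e 1))" "transfers_term t t'" "transfers_term s s'"
  shows "transfers (\<lambda>e. N (t e) (s e)) (\<lambda>e. N' (t' e) (s' e))"
  by (rule transfers_subst[OF assms(2)], rule transfers_subst[OF transfers_term_rename[OF assms(3)]])
    (use transfers_rename[OF assms(1), of "case_nat 1 (\<lambda>_. 0)"] in simp)

lemma transfers3:
  assumes "transfers (\<lambda>e. N (e 0) (e 1) (e 2)) (\<lambda>e. N' (e 0) (e 1) (e 2))"
    "transfers_term t t'" "transfers_term s s'" "transfers_term u u'"
  shows "transfers (\<lambda>e. N (t e) (s e) (u e)) (\<lambda>e. N' (t' e) (s' e) (u' e))"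
  by (rule transfers_subst[OF assms(2)], rule transfers_subst[OF transfers_term_rename[OF assms(3)]],
      rule transfers_subst[OF transfers_term_rename[OF transfers_term_rename[OF assms(4)]]])
    (use transfers_rename[OF assms(1), of "case_nat 2 (case_nat 1 (\<lambda>_. 0))"] in \<open>simp add: numeral_2_eq_2\<close>)

lemma transfers_eq_var: "transfers (\<lambda>e. e m = e n) (\<lambda>e. e m = e n)"
  by (rule transfersI[where \<phi> = "Eq (2 * m) (2 * n)"]) auto

lemma transfers_mem_var: "transfers (\<lambda>e. e m \<epsilon> e n) (\<lambda>e. e m \<epsilon> e n)"
  by (rule transfersI[where \<phi> = "Mem (2 * m) (2 * n)"]) auto

lemma transfers_term_var: "transfers_term (\<lambda>e. e n) (\<lambda>e. e n)"
  unfolding transfers_term_def by (auto intro: transfers_eq_var)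

lemma transfers_term_const: "transfers_term (\<lambda>_. a) (\<lambda>_. j a)"
  unfolding transfers_term_def
  by (auto intro!: transfersI[where \<phi> = "Eq 0 1" and c = "\<lambda>_. a"] simp: join_def)

lemma transfers_mem:
  "transfers_term t t' \<Longrightarrow> transfers_term s s' \<Longrightarrow> transfers (\<lambda>e. t e \<epsilon> s e) (\<lambda>e. t' e \<epsilon> s' e)"
  by (rule transfers2) (rule transfers_mem_var)

lemma transfers_eq:
  "transfers_term t t' \<Longrightarrow> transfers_term s s' \<Longrightarrow> transfers (\<lambda>e. t e = s e) (\<lambda>e. t' e = s' e)"
  by (rule transfers2) (rule transfers_eq_var)

named_theorems transfer_intro

lemmas [transfer_intro] = transfers_not transfers_conj transfers_disj transfers_imp
  transfers_iff transfers_all transfers_ex transfers_mem transfers_eq transfers_term_var transfers_term_const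

text \<open>Since \<open>M\<close> is transitive, all elements of the image of the bounding term lie
  in \<open>M\<close>; the relativised quantifier and the full bounded quantifier therefore
  agree.\<close>

lemma transfers_ball [transfer_intro]:
  assumes "transfers_term t t'"
    and "transfers (\<lambda>e. Q (e 0) (\<lambda>n. e (Suc n))) (\<lambda>e. Q' (e 0) (\<lambda>n. e (Suc n)))"
  shows "transfers (\<lambda>e. \<forall>x. x \<epsilon> t e \<longrightarrow> Q x e) (\<lambda>e. \<forall>x. x \<epsilon> t' e \<longrightarrow> Q' x e)"
proof (rule transfers_cong)
  show "transfers (\<lambda>e. \<forall>x. x \<epsilon> t e \<longrightarrow> Q x e) (\<lambda>e. \<forall>x\<in>M. x \<epsilon> t' e \<longrightarrow> Q' x e)"
    by (intro transfer_intro transfers_term_rename[OF assms(1)] assms(2))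
qed (use assms(1) M_mem in \<open>unfold transfers_term_def, blast\<close>)

lemma transfers_bex [transfer_intro]:
  assumes "transfers_term t t'"
    and "transfers (\<lambda>e. Q (e 0) (\<lambda>n. e (Suc n))) (\<lambda>e. Q' (e 0) (\<lambda>n. e (Suc n)))"
  shows "transfers (\<lambda>e. \<exists>x. x \<epsilon> t e \<and> Q x e) (\<lambda>e. \<exists>x. x \<epsilon> t' e \<and> Q' x e)"
proof (rule transfers_cong)
  show "transfers (\<lambda>e. \<exists>x. x \<epsilon> t e \<and> Q x e) (\<lambda>e. \<exists>x\<in>M. x \<epsilon> t' e \<and> Q' x e)"
    by (intro transfer_intro transfers_term_rename[OF assms(1)] assms(2))
qed (use assms(1) M_mem in \<open>unfold transfers_term_def, blast\<close>)

text \<open>For operations such as successor that \<open>M\<close> computes as V does: once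
  \<open>M\<close> is closed under \<open>G\<close> and the graph of \<open>G\<close> transfers to
  itself, the same \<open>G\<close> may stand on both sides.\<close>

lemma transfers_term1:
  assumes "transfers (\<lambda>e. e 0 = G (e 1)) (\<lambda>e. e 0 = G (e 1))" "\<And>x. x \<in> M \<Longrightarrow> G x \<in> M"
    and t: "transfers_term t t'"
  shows "transfers_term (\<lambda>e. G (t e)) (\<lambda>e. G (t' e))"
  unfolding transfers_term_def
proof
  show "transfers (\<lambda>e. e 0 = G (t (\<lambda>n. e (Suc n)))) (\<lambda>e. e 0 = G (t' (\<lambda>n. e (Suc n))))"
    by (rule transfers2[where N = "\<lambda>z x. z = G x" and N' = "\<lambda>z x. z = G x", OF assms(1)])
      (intro transfer_intro transfers_term_rename[OF t])+
  show "\<forall>e. (\<forall>n. e n \<in> M) \<longrightarrow> G (t' e) \<in> M"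
    using t assms(2) unfolding transfers_term_def by blast
qed

lemma transfers_term2:
  assumes "transfers (\<lambda>e. e 0 = G (e 1) (e 2)) (\<lambda>e. e 0 = G (e 1) (e 2))"
    and "\<And>x y. x \<in> M \<Longrightarrow> y \<in> M \<Longrightarrow> G x y \<in> M"
    and t: "transfers_term t t'" and s: "transfers_term s s'"
  shows "transfers_term (\<lambda>e. G (t e) (s e)) (\<lambda>e. G (t' e) (s' e))"
  unfolding transfers_term_def
proof
  show "transfers (\<lambda>e. e 0 = G (t (\<lambda>n. e (Suc n))) (s (\<lambda>n. e (Suc n))))
      (\<lambda>e. e 0 = G (t' (\<lambda>n. e (Suc n))) (s' (\<lambda>n. e (Suc n))))"
    by (rule transfers3[where N = "\<lambda>z x y. z = G x y" and N' = "\<lambda>z x y. z = G x y", OF assms(1)])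
      (intro transfer_intro transfers_term_rename[OF t] transfers_term_rename[OF s])+
  show "\<forall>e. (\<forall>n. e n \<in> M) \<longrightarrow> G (t' e) (s' e) \<in> M"
    using t s assms(2) unfolding transfers_term_def by blast
qed

lemma M_eq_iff: "x \<in> M \<Longrightarrow> y \<in> M \<Longrightarrow> x = y \<longleftrightarrow> (\<forall>z\<in>M. z \<epsilon> x \<longleftrightarrow> z \<epsilon> y)"
  using M_mem by (blast intro: set_ext)

lemma M_eqI: "x \<in> M \<Longrightarrow> (\<And>z. z \<epsilon> y \<Longrightarrow> z \<in> M) \<Longrightarrow> (\<And>z. z \<in> M \<Longrightarrow> z \<epsilon> x \<longleftrightarrow> z \<epsilon> y) \<Longrightarrow> x = y"
  using M_mem by (blast intro: set_ext)

text \<open>By transitivity, a set in \<open>M\<close> that has no elements in \<open>M\<close> is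
  empty.\<close>

lemma j_zero [simp]: "j zero = zero"
proof -
  have "(\<forall>z. \<not> z \<epsilon> zero) \<longleftrightarrow> (\<forall>z\<in>M. \<not> z \<epsilon> j zero)"
    by (rule transfer) (intro transfer_intro)
  then show ?thesis by (intro M_eqI) auto
qed

lemma transfers_term_zero [transfer_intro]: "transfers_term (\<lambda>_. zero) (\<lambda>_. zero)"
  using transfers_term_const[of zero] by simp

text \<open>Elementarity gives \<open>M\<close> a set that it takes for the unordered pair, and by
  transitivity that set has no further elements. Closure under successor, restriction and
  composition is obtained in the same way.\<close>

lemma M_upair: assumes "x \<in> M" "y \<in> M" shows "upair x y \<in> M"
proof -
  have "\<forall>x\<in>M. \<forall>y\<in>M. \<exists>z\<in>M. \<forall>w\<in>M. w \<epsilon> z \<longleftrightarrow> w = x \<or> w = y"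
  proof (rule transferD)
    show "\<forall>x y. \<exists>z. \<forall>w::'v. w \<epsilon> z \<longleftrightarrow> w = x \<or> w = y"
      using is_upair_exists unfolding is_upair_def by simp
  qed (intro transfer_intro)
  then obtain z where z: "z \<in> M" "\<forall>w\<in>M. w \<epsilon> z \<longleftrightarrow> w = x \<or> w = y"
    using assms by blast
  then have "z = upair x y" using assms by (intro M_eqI) auto
  then show ?thesis using z by simp
qed

lemma transfers_upair [transfer_intro]:
  assumes "transfers_term t t'" "transfers_term s s'"
  shows "transfers_term (\<lambda>e. upair (t e) (s e)) (\<lambda>e. upair (t' e) (s' e))"
proof (rule transfers_term2[OF _ M_upair assms])
  have "transfers (\<lambda>e. \<forall>w. w \<epsilon> e 0 \<longleftrightarrow> w = e 1 \<or> w = e 2) (\<lambda>e. \<forall>w\<in>M. w \<epsilon> e 0 \<longleftrightarrow> w = e 1 \<or> w = e 2)"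
    by (intro transfer_intro)
  moreover have "(\<forall>w. w \<epsilon> e 0 \<longleftrightarrow> w = e 1 \<or> w = e 2) \<longleftrightarrow> e 0 = upair (e 1) (e 2)"
    for e :: "nat \<Rightarrow> 'v"
    by (auto intro: set_ext)
  moreover have "(\<forall>w\<in>M. w \<epsilon> e 0 \<longleftrightarrow> w = e 1 \<or> w = e 2) \<longleftrightarrow> e 0 = upair (e 1) (e 2)"
    if "\<forall>n. e n \<in> M" for e :: "nat \<Rightarrow> 'v"
    using M_eq_iff[of "e 0" "upair (e 1) (e 2)"] that M_upair by simp
  ultimately show "transfers (\<lambda>e. e 0 = upair (e 1) (e 2)) (\<lambda>e. e 0 = upair (e 1) (e 2))"
    by (rule transfers_cong_both)
qed

lemma transfers_pair [transfer_intro]: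
  "transfers_term t t' \<Longrightarrow> transfers_term s s' \<Longrightarrow>
    transfers_term (\<lambda>e. pair (t e) (s e)) (\<lambda>e. pair (t' e) (s' e))"
  unfolding pair_def by (intro transfer_intro)

lemma M_pair: "x \<in> M \<Longrightarrow> y \<in> M \<Longrightarrow> pair x y \<in> M"
  unfolding pair_def by (intro M_upair)

lemma M_pairD: "pair x y \<in> M \<Longrightarrow> x \<in> M" "pair x y \<in> M \<Longrightarrow> y \<in> M"
  unfolding pair_def by (metis M_mem mem_upair)+

lemma M_relD: "f \<in> M \<Longrightarrow> pair x y \<epsilon> f \<Longrightarrow> x \<in> M \<and> y \<in> M"
  using M_mem M_pairD by blast

lemma j_pair: "j (pair x y) = pair (j x) (j y)"
proof -
  have "pair x y = pair x y \<longleftrightarrow> j (pair x y) = pair (j x) (j y)"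
    by (rule transfer) (intro transfers_eq transfers_pair transfers_term_const)
  then show ?thesis by simp
qed

lemma transfers_rel [transfer_intro]:
  "transfers_term t t' \<Longrightarrow> transfers_term s s' \<Longrightarrow> transfers_term u u' \<Longrightarrow>
    transfers (\<lambda>e. rel (t e) (s e) (u e)) (\<lambda>e. rel (t' e) (s' e) (u' e))"
  unfolding rel_iff by (intro transfer_intro)

section \<open>Absoluteness\<close>

lemma M_suc: assumes "x \<in> M" shows "suc x \<in> M"
proof -
  have "\<forall>x\<in>M. \<exists>y\<in>M. \<forall>z\<in>M. z \<epsilon> y \<longleftrightarrow> z \<epsilon> x \<or> z = x"
  proof (rule transferD)
    show "\<forall>x. \<exists>y. \<forall>z::'v. z \<epsilon> y \<longleftrightarrow> z \<epsilon> x \<or> z = x"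
      using mem_suc by blast
  qed (intro transfer_intro)
  then obtain y where y: "y \<in> M" "\<forall>z\<in>M. z \<epsilon> y \<longleftrightarrow> z \<epsilon> x \<or> z = x" using assms by blast
  then have "y = suc x" using assms M_mem[OF assms] by (intro M_eqI) auto
  then show ?thesis using y by simp
qed

lemma transfers_term_suc [transfer_intro]:
  assumes "transfers_term t t'"
  shows "transfers_term (\<lambda>e. suc (t e)) (\<lambda>e. suc (t' e))"
proof (rule transfers_term1[OF _ M_suc assms])
  have "transfers (\<lambda>e. \<forall>w. w \<epsilon> e 0 \<longleftrightarrow> w \<epsilon> e 1 \<or> w = e 1) (\<lambda>e. \<forall>w\<in>M. w \<epsilon> e 0 \<longleftrightarrow> w \<epsilon> e 1 \<or> w = e 1)"
    by (intro transfer_intro)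
  moreover have "(\<forall>w. w \<epsilon> e 0 \<longleftrightarrow> w \<epsilon> e 1 \<or> w = e 1) \<longleftrightarrow> e 0 = suc (e 1)" for e :: "nat \<Rightarrow> 'v"
    using is_succ_iff[of "e 0" "e 1"] unfolding is_succ_def by simp
  moreover have "(\<forall>w\<in>M. w \<epsilon> e 0 \<longleftrightarrow> w \<epsilon> e 1 \<or> w = e 1) \<longleftrightarrow> e 0 = suc (e 1)"
    if "\<forall>n. e n \<in> M" for e :: "nat \<Rightarrow> 'v"
    using M_eq_iff[of "e 0" "suc (e 1)"] that M_suc by simp
  ultimately show "transfers (\<lambda>e. e 0 = suc (e 1)) (\<lambda>e. e 0 = suc (e 1))"
    by (rule transfers_cong_both)
qed

lemma M_restr: assumes "f \<in> M" "a \<in> M" shows "restr f a \<in> M"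
proof -
  have "\<forall>f\<in>M. \<forall>a\<in>M. \<exists>r\<in>M. \<forall>z\<in>M. z \<epsilon> r \<longleftrightarrow> z \<epsilon> f \<and> (\<exists>x\<in>M. \<exists>y\<in>M. x \<epsilon> a \<and> z = pair x y)"
  proof (rule transferD)
    show "\<forall>f a. \<exists>r. \<forall>z. z \<epsilon> r \<longleftrightarrow> z \<epsilon> f \<and> (\<exists>x y. x \<epsilon> a \<and> z = pair x y)"
      using mem_restr by blast
  qed (intro transfer_intro)
  then obtain r where r: "r \<in> M" "\<forall>z\<in>M. z \<epsilon> r \<longleftrightarrow> z \<epsilon> f \<and> (\<exists>x\<in>M. \<exists>y\<in>M. x \<epsilon> a \<and> z = pair x y)"
    using assms by blast
  have "r = restr f a"
  proof (rule M_eqI[OF r(1)])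
    fix z
    show "z \<in> M" if "z \<epsilon> restr f a" using that M_mem[OF assms(1)] unfolding mem_restr by blast
    show "z \<epsilon> r \<longleftrightarrow> z \<epsilon> restr f a" if "z \<in> M"
      using r(2) that M_pairD unfolding mem_restr by blast
  qed
  then show ?thesis using r by simp
qed

lemma transfers_term_restr [transfer_intro]:
  assumes "transfers_term t t'" "transfers_term s s'"
  shows "transfers_term (\<lambda>e. restr (t e) (s e)) (\<lambda>e. restr (t' e) (s' e))"
proof (rule transfers_term2[OF _ M_restr assms])
  have "transfers (\<lambda>e. \<forall>z. z \<epsilon> e 0 \<longleftrightarrow> z \<epsilon> e 1 \<and> (\<exists>x y. x \<epsilon> e 2 \<and> z = pair x y))
      (\<lambda>e. \<forall>z\<in>M. z \<epsilon> e 0 \<longleftrightarrow> z \<epsilon> e 1 \<and> (\<exists>x\<in>M. \<exists>y\<in>M. x \<epsilon> e 2 \<and> z = pair x y))"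
    by (intro transfer_intro)
  moreover have "(\<forall>z. z \<epsilon> e 0 \<longleftrightarrow> z \<epsilon> e 1 \<and> (\<exists>x y. x \<epsilon> e 2 \<and> z = pair x y)) \<longleftrightarrow> e 0 = restr (e 1) (e 2)"
    for e :: "nat \<Rightarrow> 'v"
    using is_restriction_iff[of "e 0" "e 1" "e 2"] unfolding is_restriction_def is_opair_iff .
  moreover have "(\<forall>z\<in>M. z \<epsilon> e 0 \<longleftrightarrow> z \<epsilon> e 1 \<and> (\<exists>x\<in>M. \<exists>y\<in>M. x \<epsilon> e 2 \<and> z = pair x y))
      \<longleftrightarrow> e 0 = restr (e 1) (e 2)" if "\<forall>n. e n \<in> M" for e :: "nat \<Rightarrow> 'v"
  proof -
    have "(\<exists>x\<in>M. \<exists>y\<in>M. x \<epsilon> e 2 \<and> z = pair x y) \<longleftrightarrow> (\<exists>x y. x \<epsilon> e 2 \<and> z = pair x y)" if "z \<in> M" for z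
      using that M_pairD by blast
    then show ?thesis using M_eq_iff[of "e 0" "restr (e 1) (e 2)"] that M_restr by (simp add: mem_restr)
  qed
  ultimately show "transfers (\<lambda>e. e 0 = restr (e 1) (e 2)) (\<lambda>e. e 0 = restr (e 1) (e 2))"
    by (rule transfers_cong_both)
qed

text \<open>This serves to recover a sequence of conditions from a sequence of indices in
  \<open>M\<close> and an enumeration in \<open>M\<close>. The set that \<open>M\<close> takes for
  the composition is the true one, since components of pairs in sets of \<open>M\<close> lie in
  \<open>M\<close>.\<close>

lemma M_relational_composition:
  assumes "g \<in> M" "h \<in> M" "s \<in> M"
    and f: "\<And>z. z \<epsilon> f \<longleftrightarrow> (\<exists>x w y. x \<epsilon> s \<and> pair x w \<epsilon> g \<and> pair w y \<epsilon> h \<and> z = pair x y)"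
  shows "f \<in> M"
proof -
  have "\<forall>g\<in>M. \<forall>h\<in>M. \<forall>s\<in>M. \<exists>f\<in>M. \<forall>z\<in>M.
      z \<epsilon> f \<longleftrightarrow> (\<exists>x\<in>M. \<exists>w\<in>M. \<exists>y\<in>M. x \<epsilon> s \<and> pair x w \<epsilon> g \<and> pair w y \<epsilon> h \<and> z = pair x y)"
  proof (rule transferD)
    show "\<forall>g h s. \<exists>f. \<forall>z. z \<epsilon> f \<longleftrightarrow> (\<exists>x w y. x \<epsilon> s \<and> pair x w \<epsilon> g \<and> pair w y \<epsilon> h \<and> z = pair x y)"
    proof (intro allI)
      fix g h s
      let ?C = "\<lambda>z. \<exists>x w y. x \<epsilon> s \<and> pair x w \<epsilon> g \<and> pair w y \<epsilon> h \<and> z = pair x y"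
      have "z \<epsilon> sep (cart s (Un_set (Un_set h))) ?C \<longleftrightarrow> z \<epsilon> cart s (Un_set (Un_set h)) \<and> ?C z" for z
        by (rule mem_sep) (intro definable_intro)
      \<comment> \<open>The second component of a Kuratowski pair in \<open>h\<close> lies in the
        double union of \<open>h\<close>, so Separation inside a product applies.\<close>
      moreover have "y \<epsilon> Un_set (Un_set h)" if "pair w y \<epsilon> h" for w y
        using that unfolding mem_Un_set pair_def by (metis mem_upair)
      ultimately have "z \<epsilon> sep (cart s (Un_set (Un_set h))) ?C \<longleftrightarrow> ?C z" for z
        unfolding mem_cart by blast
      then show "\<exists>f. \<forall>z. z \<epsilon> f \<longleftrightarrow> ?C z" by blast
    qed
  qed (intro transfer_intro)
  then obtain f' where f': "f' \<in> M" "\<forall>z\<in>M.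
      z \<epsilon> f' \<longleftrightarrow> (\<exists>x\<in>M. \<exists>w\<in>M. \<exists>y\<in>M. x \<epsilon> s \<and> pair x w \<epsilon> g \<and> pair w y \<epsilon> h \<and> z = pair x y)"
    using assms(1-3) by blast
  have "f' = f"
  proof (rule M_eqI[OF f'(1)])
    fix z
    show "z \<in> M" if "z \<epsilon> f"
      using that M_relD[OF assms(1)] M_relD[OF assms(2)] M_pair unfolding f by blast
    show "z \<epsilon> f' \<longleftrightarrow> z \<epsilon> f" if "z \<in> M"
    proof -
      have "(\<exists>x\<in>M. \<exists>w\<in>M. \<exists>y\<in>M. x \<epsilon> s \<and> pair x w \<epsilon> g \<and> pair w y \<epsilon> h \<and> z = pair x y) \<longleftrightarrow> z \<epsilon> f"
        unfolding f using M_relD[OF assms(1)] M_relD[OF assms(2)] by blast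
      then show ?thesis using f'(2) that by blast
    qed
  qed
  then show ?thesis using f' by simp
qed

lemma transfers_is_fun [transfer_intro]:
  assumes "transfers_term t t'" "transfers_term s s'" "transfers_term u u'"
  shows "transfers (\<lambda>e. is_fun (t e) (s e) (u e)) (\<lambda>e. is_fun (t' e) (s' e) (u' e))"
proof (rule transfers3[OF _ assms])
  \<comment> \<open>Every bound is attached directly to its quantifier, the shape in which the rules
    for bounded quantifiers apply. The quantifiers over values remain relativised, which is harmless
    because all values of a function in \<open>M\<close> lie in \<open>M\<close>.\<close>
  have V: "is_fun f a b \<longleftrightarrow> (\<forall>z. z \<epsilon> f \<longrightarrow> (\<exists>x. x \<epsilon> a \<and> (\<exists>y. y \<epsilon> b \<and> z = pair x y))) \<and>
      (\<forall>x. x \<epsilon> a \<longrightarrow> (\<exists>y. pair x y \<epsilon> f \<and> (\<forall>y'. pair x y' \<epsilon> f \<longrightarrow> y' = y)))" for f a b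
    unfolding is_fun_def rel_iff is_opair_iff Ex1_def by blast
  show "transfers (\<lambda>e. is_fun (e 0) (e 1) (e 2)) (\<lambda>e. is_fun (e 0) (e 1) (e 2))"
  proof (rule transfers_cong)
    show "transfers (\<lambda>e. is_fun (e 0) (e 1) (e 2))
        (\<lambda>e. (\<forall>z. z \<epsilon> e 0 \<longrightarrow> (\<exists>x. x \<epsilon> e 1 \<and> (\<exists>y. y \<epsilon> e 2 \<and> z = pair x y))) \<and>
          (\<forall>x. x \<epsilon> e 1 \<longrightarrow> (\<exists>y\<in>M. pair x y \<epsilon> e 0 \<and> (\<forall>y'\<in>M. pair x y' \<epsilon> e 0 \<longrightarrow> y' = y))))"
      unfolding V by (intro transfer_intro)
    fix e :: "nat \<Rightarrow> 'v" assume "\<forall>n. e n \<in> M"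
    then have "\<And>x y. pair x y \<epsilon> e 0 \<Longrightarrow> y \<in> M" using M_relD by blast
    then show "((\<forall>z. z \<epsilon> e 0 \<longrightarrow> (\<exists>x. x \<epsilon> e 1 \<and> (\<exists>y. y \<epsilon> e 2 \<and> z = pair x y))) \<and>
          (\<forall>x. x \<epsilon> e 1 \<longrightarrow> (\<exists>y\<in>M. pair x y \<epsilon> e 0 \<and> (\<forall>y'\<in>M. pair x y' \<epsilon> e 0 \<longrightarrow> y' = y))))
        \<longleftrightarrow> is_fun (e 0) (e 1) (e 2)"
      unfolding V by blast
  qed
qed

lemma transfer_is_bij:
  "is_bij f a b \<longleftrightarrow> is_bij (j f) (j a) (j b)"
proof -
  have V: "is_bij f a b \<longleftrightarrow> is_fun f a b \<and>
      (\<forall>y. y \<epsilon> b \<longrightarrow> (\<exists>x. pair x y \<epsilon> f \<and> (\<forall>x'. pair x' y \<epsilon> f \<longrightarrow> x' = x)))" for f a b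
    unfolding is_bij_def rel_iff Ex1_def by blast
  have "is_bij f a b \<longleftrightarrow> is_fun (j f) (j a) (j b) \<and>
      (\<forall>y. y \<epsilon> j b \<longrightarrow> (\<exists>x\<in>M. pair x y \<epsilon> j f \<and> (\<forall>x'\<in>M. pair x' y \<epsilon> j f \<longrightarrow> x' = x)))"
    unfolding V by (rule transfer) (intro transfer_intro)
  then show ?thesis unfolding V using M_relD[OF j_in_M] by blast
qed

lemma transfers_is_ordinal [transfer_intro]:
  assumes "transfers_term t t'"
  shows "transfers (\<lambda>e. is_ordinal (t e)) (\<lambda>e. is_ordinal (t' e))"
  by (rule transfers1[OF _ assms])
    (unfold is_ordinal_def is_trans_def is_subset_def, intro transfer_intro)

lemma transfers_stage_marking [transfer_intro]:
  assumes "transfers_term t t'" "transfers_term s s'"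
  shows "transfers (\<lambda>e. stage_marking (t e) (s e)) (\<lambda>e. stage_marking (t' e) (s' e))"
proof (rule transfers2[OF _ assms], rule transfers_cong)
  show "transfers (\<lambda>e. stage_marking (e 0) (e 1))
      (\<lambda>e. \<forall>t\<in>M. t \<epsilon> e 0 \<or> t = e 0 \<longrightarrow> (t \<epsilon> e 1 \<longleftrightarrow> t = zero \<or> (\<exists>u\<in>M. t = suc u \<and> \<not> u \<epsilon> e 1)))"
    unfolding stage_marking_def by (intro transfer_intro)
  fix e :: "nat \<Rightarrow> 'v" assume e: "\<forall>n. e n \<in> M"
  have "(\<exists>u\<in>M. t = suc u \<and> \<not> u \<epsilon> e 1) \<longleftrightarrow> (\<exists>u. t = suc u \<and> \<not> u \<epsilon> e 1)" if "t \<in> M" for t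
    using that M_mem mem_suc by blast
  moreover have "t \<in> M" if "t \<epsilon> e 0 \<or> t = e 0" for t using that e M_mem by blast
  ultimately show "(\<forall>t\<in>M. t \<epsilon> e 0 \<or> t = e 0 \<longrightarrow> (t \<epsilon> e 1 \<longleftrightarrow> t = zero \<or> (\<exists>u\<in>M. t = suc u \<and> \<not> u \<epsilon> e 1)))
      \<longleftrightarrow> stage_marking (e 0) (e 1)"
    unfolding stage_marking_def by blast
qed

section \<open>Stages, dense sets and strategies as seen by the target model\<close>

text \<open>By elementarity \<open>M\<close> contains a marking for s, and by uniqueness every
  marking, whether in \<open>M\<close> or not, gives the same verdict at s.\<close>

lemma stage_of_I_in_M:
  assumes "is_ordinal s" "s \<in> M"
  shows "(\<exists>m\<in>M. s \<epsilon> m \<and> stage_marking s m) \<longleftrightarrow> stage_of_I s"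
proof -
  have "\<forall>s\<in>M. is_ordinal s \<longrightarrow> (\<exists>m\<in>M. stage_marking s m)"
  proof (rule transferD)
    show "\<forall>s. is_ordinal s \<longrightarrow> (\<exists>m. stage_marking s m)" using stage_marking_exists by blast
  qed (intro transfer_intro)
  then obtain m where "m \<in> M" "stage_marking s m" using assms by blast
  then show ?thesis using stage_of_I_marking[OF assms(1)] unfolding stage_of_I_iff by blast
qed

lemma transfer_dense_open:
  assumes "dense_open P R D" shows "dense_open (j P) (j R) (j D)"
proof -
  have V: "dense_open P R D \<longleftrightarrow> (\<forall>z. z \<epsilon> D \<longrightarrow> z \<epsilon> P) \<and> (\<forall>p. p \<epsilon> P \<longrightarrow> (\<exists>q. q \<epsilon> D \<and> rel R p q)) \<and>
      (\<forall>p. p \<epsilon> D \<longrightarrow> (\<forall>q. q \<epsilon> P \<longrightarrow> rel R p q \<longrightarrow> q \<epsilon> D))" for P R D :: 'v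
    unfolding dense_open_def is_subset_def by blast
  show ?thesis
    using assms unfolding V[of "j P"] by (rule transferD) (unfold V, intro transfer_intro)
qed

lemma transfer_forcing_notion:
  assumes "forcing_notion P R" shows "forcing_notion (j P) (j R)"
proof -
  have V: "forcing_notion P R \<longleftrightarrow> (\<forall>p. p \<epsilon> P \<longrightarrow> rel R p p) \<and>
      (\<forall>p. p \<epsilon> P \<longrightarrow> (\<forall>q. q \<epsilon> P \<longrightarrow> (\<forall>r. r \<epsilon> P \<longrightarrow> rel R p q \<and> rel R q r \<longrightarrow> rel R p r)))"
    for P R :: 'v unfolding forcing_notion_def by blast
  show ?thesis
    using assms unfolding V[of "j P"] by (rule transferD) (unfold V, intro transfer_intro)
qed

lemma j_mem_iff: "j x \<epsilon> j y \<longleftrightarrow> x \<epsilon> y"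
  by (rule transfer[symmetric]) (intro transfers_mem transfers_term_const)

lemma follows_iff:
  "follows \<tau> b f \<longleftrightarrow> (\<forall>s. s \<epsilon> b \<and> \<not> stage_of_I s \<longrightarrow> (\<exists>y. rel \<tau> (restr f s) y \<and> rel f s y))"
  unfolding follows_def is_restriction_iff by blast

text \<open>The model \<open>M\<close> takes \<open>j P\<close> to be strategically closed below
  \<open>j k\<close>. Positions, stages and following a strategy mean the same in \<open>M\<close>
  and V for plays in \<open>M\<close>, so the strategy found in \<open>M\<close> can be used in V
  against every position that belongs to \<open>M\<close>.\<close>

lemma transfer_strategically_closed:
  assumes "strategically_closed_below k P R" "is_ordinal k" "a \<epsilon> j k"
  shows "\<exists>\<tau> d. is_fun \<tau> d (j P) \<and>
    (\<forall>b f. f \<in> M \<and> b \<epsilon> a \<and> \<not> stage_of_I b \<and> is_position (j P) (j R) b f \<and> follows \<tau> b f \<longrightarrow>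
      (\<exists>q. rel \<tau> f q \<and> (\<forall>s x. s \<epsilon> b \<and> rel f s x \<longrightarrow> rel (j R) x q)))"
proof -
  have "\<forall>a. a \<epsilon> j k \<longrightarrow> (\<exists>\<tau>\<in>M. (\<exists>d\<in>M. is_fun \<tau> d (j P)) \<and>
      (\<forall>b\<in>M. \<forall>f\<in>M. b \<epsilon> a \<and> \<not> (\<exists>m\<in>M. b \<epsilon> m \<and> stage_marking b m) \<and>
        (is_fun f b (j P) \<and>
          (\<forall>s\<in>M. \<forall>t\<in>M. \<forall>x\<in>M. \<forall>y\<in>M. s \<epsilon> t \<and> t \<epsilon> b \<and> rel f s x \<and> rel f t y \<longrightarrow> rel (j R) x y)) \<and>
        (\<forall>s\<in>M. s \<epsilon> b \<and> \<not> (\<exists>m\<in>M. s \<epsilon> m \<and> stage_marking s m) \<longrightarrow>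
          (\<exists>y\<in>M. rel \<tau> (restr f s) y \<and> rel f s y)) \<longrightarrow>
        (\<exists>q\<in>M. rel \<tau> f q \<and> (\<forall>s\<in>M. \<forall>x\<in>M. s \<epsilon> b \<and> rel f s x \<longrightarrow> rel (j R) x q))))"
    using assms(1) unfolding strategically_closed_below_def winning_strategy_II_def is_position_def
      follows_iff stage_of_I_iff
    by (rule transferD) (intro transfer_intro)
  from spec[OF this, of a, THEN mp, OF assms(3)] obtain \<tau> where "\<tau> \<in> M"
    and *: "(\<exists>d\<in>M. is_fun \<tau> d (j P)) \<and>
      (\<forall>b\<in>M. \<forall>f\<in>M. b \<epsilon> a \<and> \<not> (\<exists>m\<in>M. b \<epsilon> m \<and> stage_marking b m) \<and>
        (is_fun f b (j P) \<and>
          (\<forall>s\<in>M. \<forall>t\<in>M. \<forall>x\<in>M. \<forall>y\<in>M. s \<epsilon> t \<and> t \<epsilon> b \<and> rel f s x \<and> rel f t y \<longrightarrow> rel (j R) x y)) \<and>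
        (\<forall>s\<in>M. s \<epsilon> b \<and> \<not> (\<exists>m\<in>M. s \<epsilon> m \<and> stage_marking s m) \<longrightarrow>
          (\<exists>y\<in>M. rel \<tau> (restr f s) y \<and> rel f s y)) \<longrightarrow>
        (\<exists>q\<in>M. rel \<tau> f q \<and> (\<forall>s\<in>M. \<forall>x\<in>M. s \<epsilon> b \<and> rel f s x \<longrightarrow> rel (j R) x q)))"
    by (rule bexE) (rule that)
  obtain d where \<tau>: "is_fun \<tau> d (j P)" using * by blast
  note win = conjunct2[OF *, THEN bspec, THEN bspec, THEN mp]
  have "is_ordinal (j k)" using assms(2) by (rule transferD) (intro transfers_is_ordinal transfers_term_const)
  then have a: "is_ordinal a" "a \<in> M" using assms(3) ordinal_mem M_mem j_in_M by blast+
  have "\<exists>q. rel \<tau> f q \<and> (\<forall>s x. s \<epsilon> b \<and> rel f s x \<longrightarrow> rel (j R) x q)"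
    if f: "f \<in> M" and b: "b \<epsilon> a" and I: "\<not> stage_of_I b" and pos: "is_position (j P) (j R) b f"
      and fol: "follows \<tau> b f" for b f
  proof -
    have bM: "b \<in> M" "is_ordinal b" using a b M_mem ordinal_mem by blast+
    have fM: "x \<in> M \<and> y \<in> M" if "rel f x y" for x y using that f M_relD unfolding rel_iff by blast
    have sM: "s \<in> M" "is_ordinal s" if "s \<epsilon> b" for s using that bM M_mem ordinal_mem by blast+
    \<comment> \<open>The premises of \<open>win\<close> are relativised to \<open>M\<close>;
      transitivity and \<open>stage_of_I_in_M\<close> derive them from the true ones.\<close>
    have "\<exists>q\<in>M. rel \<tau> f q \<and> (\<forall>s\<in>M. \<forall>x\<in>M. s \<epsilon> b \<and> rel f s x \<longrightarrow> rel (j R) x q)"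
    proof (rule win[OF bM(1) f], intro conjI)
      show "b \<epsilon> a" by (rule b)
      show "\<not> (\<exists>m\<in>M. b \<epsilon> m \<and> stage_marking b m)" using I stage_of_I_in_M bM by blast
      show "is_fun f b (j P)"
        and "\<forall>s\<in>M. \<forall>t\<in>M. \<forall>x\<in>M. \<forall>y\<in>M. s \<epsilon> t \<and> t \<epsilon> b \<and> rel f s x \<and> rel f t y \<longrightarrow> rel (j R) x y"
        using pos unfolding is_position_def by blast+
      show "\<forall>s\<in>M. s \<epsilon> b \<and> \<not> (\<exists>m\<in>M. s \<epsilon> m \<and> stage_marking s m) \<longrightarrow>
          (\<exists>y\<in>M. rel \<tau> (restr f s) y \<and> rel f s y)"
        using fol fM sM stage_of_I_in_M unfolding follows_iff by blast
    qed
    then show ?thesis using fM by blast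
  qed
  then show ?thesis using \<tau> by blast
qed

end

section \<open>The critical point\<close>

locale critical_embedding = embedding +
  fixes \<kappa> assumes critical: "critical_point j \<kappa>"
begin

lemma kappa_ordinal: "is_ordinal \<kappa>" and j_kappa: "j \<kappa> \<noteq> \<kappa>" and j_fixed: "a \<epsilon> \<kappa> \<Longrightarrow> j a = a"
  using critical unfolding critical_point_def by auto

lemma j_kappa_ordinal: "is_ordinal (j \<kappa>)"
  using kappa_ordinal by (rule transferD) (intro transfers_is_ordinal transfers_term_const)

lemma kappa_subset: "a \<epsilon> \<kappa> \<Longrightarrow> a \<epsilon> j \<kappa>"
  using j_mem_iff[of a \<kappa>] j_fixed by simp

text \<open>Ordinals below \<kappa> are fixed and hence lie below \<open>j \<kappa>\<close>; if
  \<open>j \<kappa>\<close> were one of them, it would be an element of itself.\<close>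

lemma kappa_mem: "\<kappa> \<epsilon> j \<kappa>"
  using ordinal_linear[OF kappa_ordinal j_kappa_ordinal] j_kappa kappa_subset not_mem_self by auto

lemma j_suc: "j (suc a) = suc (j a)"
  using refl[of "suc a"]
  by (rule transferD) (intro transfers_eq transfers_term_suc transfers_term_const)

text \<open>If \<kappa> were the successor of a fixed ordinal, it would be fixed as well.\<close>

lemma suc_kappa: assumes "a \<epsilon> \<kappa>" shows "suc a \<epsilon> \<kappa>"
proof -
  have "is_ordinal (suc a)" using assms kappa_ordinal ordinal_mem ordinal_suc by blast
  moreover have "suc a \<noteq> \<kappa>" using j_suc[of a] j_fixed[OF assms] j_kappa by auto
  moreover have "\<not> \<kappa> \<epsilon> suc a" using assms not_mem_cycle not_mem_self by auto
  ultimately show ?thesis using ordinal_linear[OF _ kappa_ordinal] by blast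
qed

lemma zero_kappa: "zero \<epsilon> \<kappa>"
  using ordinal_linear[OF ordinal_zero kappa_ordinal] j_zero j_kappa by auto

lemma two_kappa: "two \<epsilon> \<kappa>"
  using zero_kappa suc_kappa by blast

lemma suc_j_kappa: assumes "a \<epsilon> j \<kappa>" shows "suc a \<epsilon> j \<kappa>"
proof -
  have "\<forall>a. a \<epsilon> \<kappa> \<longrightarrow> suc a \<epsilon> \<kappa>" using suc_kappa by blast
  then have "\<forall>a. a \<epsilon> j \<kappa> \<longrightarrow> suc a \<epsilon> j \<kappa>" by (rule transferD) (intro transfer_intro)
  then show ?thesis using assms by blast
qed

section \<open>Sets of functions between ordinals below the critical point\<close>

text \<open>Both \<open>g\<close> and \<open>j g\<close> are functions from \<open>a\<close> to
  \<open>b\<close>, so all their elements are pairs of ordinals below \<kappa>, which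
  \<open>j\<close> fixes.\<close>

lemma j_fun_fixed:
  assumes "a \<epsilon> \<kappa>" "b \<epsilon> \<kappa>" "is_fun g a b" shows "j g = g"
proof (rule set_ext)
  have fixed: "j (pair x y) = pair x y" if "x \<epsilon> a" "y \<epsilon> b" for x y
    using that assms ordinal_trans[OF kappa_ordinal] j_fixed by (simp add: j_pair)
  have "is_fun (j g) (j a) (j b)"
    using assms(3) by (rule transferD) (intro transfers_is_fun transfers_term_const)
  then have jg: "is_fun (j g) a b" using assms j_fixed by simp
  fix z
  have "\<exists>x y. x \<epsilon> a \<and> y \<epsilon> b \<and> z = pair x y" if "z \<epsilon> j g \<or> z \<epsilon> g"
    using that assms(3) jg unfolding is_fun_def by auto
  then have "j z = z" if "z \<epsilon> j g \<or> z \<epsilon> g" using that fixed by blast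
  then show "z \<epsilon> j g \<longleftrightarrow> z \<epsilon> g" using j_mem_iff[of z g] by auto
qed

text \<open>The value of \<open>j f\<close> at \<open>\<kappa>\<close> would be fixed by \<open>j\<close>, hence a value of \<open>f\<close> below \<open>\<kappa>\<close>.\<close>

lemma no_injection_into_funs:
  assumes a: "a \<epsilon> \<kappa>" and b: "b \<epsilon> \<kappa>" and f: "is_fun f \<kappa> (funs a b)"
    and inj: "\<And>x y. x \<epsilon> \<kappa> \<Longrightarrow> y \<epsilon> \<kappa> \<Longrightarrow> ap f x = ap f y \<Longrightarrow> x = y"
  shows False
proof -
  have fun_f: "fun_on f \<kappa>" using f is_fun_iff by blast
  have "\<forall>x. x \<epsilon> \<kappa> \<longrightarrow> (\<exists>g. pair x g \<epsilon> f \<and> is_fun g a b)"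
    using f unfolding is_fun_iff[of f] mem_funs using fun_on_ap[OF fun_f] by blast
  then have "\<forall>x. x \<epsilon> j \<kappa> \<longrightarrow> (\<exists>g\<in>M. pair x g \<epsilon> j f \<and> is_fun g (j a) (j b))"
    by (rule transferD) (intro transfer_intro)
  then obtain g where g: "pair \<kappa> g \<epsilon> j f" "is_fun g (j a) (j b)" using kappa_mem by blast
  then have jg: "j g = g" using a b j_fixed j_fun_fixed by simp
  have "\<forall>x y g. pair x g \<epsilon> f \<and> pair y g \<epsilon> f \<longrightarrow> x = y"
    unfolding fun_on_ap[OF fun_f] using inj by blast
  then have "\<forall>x\<in>M. \<forall>y\<in>M. \<forall>g\<in>M. pair x g \<epsilon> j f \<and> pair y g \<epsilon> j f \<longrightarrow> x = y"
    by (rule transferD) (intro transfer_intro)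
  then have inj_j: "x = y" if "pair x h \<epsilon> j f" "pair y h \<epsilon> j f" for x y h
    using that M_relD[OF j_in_M] by blast
  \<comment> \<open>Because \<open>g\<close> equals \<open>j g\<close> and is a value of
    \<open>j f\<close>, elementarity makes \<open>g\<close> a value of \<open>f\<close> at some x
    below \<kappa>. Then \<open>j f\<close> takes it at x as well as at \<kappa>, against
    injectivity.\<close>
  have "(\<exists>x. x \<epsilon> \<kappa> \<and> pair x g \<epsilon> f) \<longleftrightarrow> (\<exists>x. x \<epsilon> j \<kappa> \<and> pair x (j g) \<epsilon> j f)"
    by (rule transfer) (intro transfer_intro)
  then obtain x where x: "x \<epsilon> \<kappa>" "pair x g \<epsilon> f" using g kappa_mem jg by auto
  then have "pair x g \<epsilon> j f" using j_mem_iff[of "pair x g" f] by (simp add: j_pair j_fixed jg)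
  then have "x = \<kappa>" using inj_j g by blast
  then show False using x not_mem_self by blast
qed

text \<open>An enumeration along \<kappa> must stop early, since otherwise it would be an injection
  of \<kappa>.\<close>

lemma funs_small:
  assumes "a \<epsilon> \<kappa>" "b \<epsilon> \<kappa>" shows "\<exists>x h. x \<epsilon> \<kappa> \<and> is_bij h x (funs a b)"
  using enumerate[OF kappa_ordinal, of "funs a b"] no_injection_into_funs[OF assms] by blast

text \<open>The smallness of the set of functions from a to 2, for all a below \<kappa>, is
  transferred and then applied to \<kappa> itself, which lies below \<open>j \<kappa>\<close>. The
  bijection is spelled out by its pairs, since it covers just those functions that belong to
  \<open>M\<close>.\<close>

lemma funs_kappa_small_in_M:
  "\<exists>x h. x \<epsilon> j \<kappa> \<and>
    (\<forall>y. y \<epsilon> x \<longrightarrow> (\<exists>!g. pair y g \<epsilon> h)) \<and>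
    (\<forall>y g. y \<epsilon> x \<and> pair y g \<epsilon> h \<longrightarrow> is_fun g \<kappa> two) \<and>
    (\<forall>g. g \<in> M \<and> is_fun g \<kappa> two \<longrightarrow> (\<exists>!y. y \<epsilon> x \<and> pair y g \<epsilon> h))"
proof -
  have "\<forall>a. a \<epsilon> \<kappa> \<longrightarrow> (\<exists>x. x \<epsilon> \<kappa> \<and> (\<exists>h.
    (\<forall>y. y \<epsilon> x \<longrightarrow> (\<exists>g. pair y g \<epsilon> h \<and> is_fun g a two \<and> (\<forall>g'. pair y g' \<epsilon> h \<longrightarrow> g' = g))) \<and>
    (\<forall>g. is_fun g a two \<longrightarrow> (\<exists>y. y \<epsilon> x \<and> (pair y g \<epsilon> h \<and> (\<forall>z. z \<epsilon> x \<longrightarrow> pair z g \<epsilon> h \<longrightarrow> z = y))))))"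
  proof (intro allI impI)
    fix a assume "a \<epsilon> \<kappa>"
    then obtain x h where x: "x \<epsilon> \<kappa>" and h: "is_bij h x (funs a two)"
      using funs_small two_kappa by blast
    have fun_h: "fun_on h x" using h is_bij_iff by blast
    show "\<exists>x. x \<epsilon> \<kappa> \<and> (\<exists>h.
      (\<forall>y. y \<epsilon> x \<longrightarrow> (\<exists>g. pair y g \<epsilon> h \<and> is_fun g a two \<and> (\<forall>g'. pair y g' \<epsilon> h \<longrightarrow> g' = g))) \<and>
      (\<forall>g. is_fun g a two \<longrightarrow> (\<exists>y. y \<epsilon> x \<and> (pair y g \<epsilon> h \<and> (\<forall>z. z \<epsilon> x \<longrightarrow> pair z g \<epsilon> h \<longrightarrow> z = y)))))"
    proof (rule exI[of _ x], rule conjI[OF x], rule exI[of _ h], intro conjI allI impI)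
      show "\<exists>g. pair y g \<epsilon> h \<and> is_fun g a two \<and> (\<forall>g'. pair y g' \<epsilon> h \<longrightarrow> g' = g)" if "y \<epsilon> x" for y
        using that h unfolding is_bij_iff fun_on_ap[OF fun_h] mem_funs by blast
      fix g assume "is_fun g a two"
      then obtain y where "y \<epsilon> x" "ap h y = g" using h unfolding is_bij_iff mem_funs by blast
      then show "\<exists>y. y \<epsilon> x \<and> (pair y g \<epsilon> h \<and> (\<forall>z. z \<epsilon> x \<longrightarrow> pair z g \<epsilon> h \<longrightarrow> z = y))"
        using h unfolding is_bij_iff fun_on_ap[OF fun_h] by blast
    qed
  qed
  then have "\<forall>a. a \<epsilon> j \<kappa> \<longrightarrow> (\<exists>x. x \<epsilon> j \<kappa> \<and> (\<exists>h\<in>M.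
    (\<forall>y. y \<epsilon> x \<longrightarrow> (\<exists>g\<in>M. pair y g \<epsilon> h \<and> is_fun g a two \<and> (\<forall>g'\<in>M. pair y g' \<epsilon> h \<longrightarrow> g' = g))) \<and>
    (\<forall>g\<in>M. is_fun g a two \<longrightarrow> (\<exists>y. y \<epsilon> x \<and> (pair y g \<epsilon> h \<and> (\<forall>z. z \<epsilon> x \<longrightarrow> pair z g \<epsilon> h \<longrightarrow> z = y))))))"
    by (rule transferD) (intro transfer_intro)
  then obtain x h where x: "x \<epsilon> j \<kappa>" and "h \<in> M"
    and h: "\<forall>y. y \<epsilon> x \<longrightarrow> (\<exists>g\<in>M. pair y g \<epsilon> h \<and> is_fun g \<kappa> two \<and> (\<forall>g'\<in>M. pair y g' \<epsilon> h \<longrightarrow> g' = g))"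
      "\<forall>g\<in>M. is_fun g \<kappa> two \<longrightarrow> (\<exists>y. y \<epsilon> x \<and> (pair y g \<epsilon> h \<and> (\<forall>z. z \<epsilon> x \<longrightarrow> pair z g \<epsilon> h \<longrightarrow> z = y)))"
    using kappa_mem by blast
  have hM: "\<And>y g. pair y g \<epsilon> h \<Longrightarrow> g \<in> M" using \<open>h \<in> M\<close> M_relD by blast
  show ?thesis
  proof (rule exI[of _ x], rule exI[of _ h], rule conjI[OF x], intro conjI allI impI)
    show "\<exists>!g. pair y g \<epsilon> h" if "y \<epsilon> x" for y using h(1) that hM by metis
    show "is_fun g \<kappa> two" if "y \<epsilon> x \<and> pair y g \<epsilon> h" for y g using h(1) that hM by metis
    show "\<exists>!y. y \<epsilon> x \<and> pair y g \<epsilon> h" if "g \<in> M \<and> is_fun g \<kappa> two" for g using h(2) that by metis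
  qed
qed

end

section \<open>Consequences of closure under sequences of length \<open>2^\<kappa>\<close>\<close>

locale closed_embedding = critical_embedding +
  fixes \<mu>
  assumes two_power: "is_two_power \<mu> \<kappa>"
    and closed: "is_fun f \<mu> (j \<kappa>) \<Longrightarrow> f \<in> M"
begin

lemma mu_enumerates: "\<exists>G. is_bij G \<mu> (funs \<kappa> two)"
  using two_power funs_eqI[of _ \<kappa> two] unfolding is_two_power_def is_two_iff is_card_of_def by blast

lemma mu_cardinal: "is_cardinal \<mu>"
  using two_power unfolding is_two_power_def is_card_of_def by blast

lemma mu_ordinal: "is_ordinal \<mu>"
  using mu_cardinal unfolding is_cardinal_def by blast

text \<open>Cantor's diagonal argument: if \<mu> were below \<kappa>, the function on \<kappa> that
  differs at each x below \<mu> from the x-th enumerated function could not be enumerated.\<close>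

lemma kappa_subset_mu: assumes "x \<epsilon> \<kappa>" shows "x \<epsilon> \<mu>"
proof -
  have "\<not> \<mu> \<epsilon> \<kappa>"
  proof
    assume "\<mu> \<epsilon> \<kappa>"
    obtain G where G: "is_bij G \<mu> (funs \<kappa> two)" using mu_enumerates by blast
    \<comment> \<open>For x in \<kappa> beyond \<mu>, \<open>ap G x\<close> has no prescribed
      meaning, but the value of \<open>?H\<close> is still 0 or 1, and the contradiction is drawn at
      an x below \<mu>.\<close>
    let ?H = "\<lambda>x. if ap (ap G x) x = zero then suc zero else zero"
    have H: "definable_term (\<lambda>e. ?H (e 0))" by (intro definable_intro)
    have "lam \<kappa> ?H \<epsilon> funs \<kappa> two"
      unfolding mem_funs by (rule is_fun_lam[OF H]) simp
    then obtain x where x: "x \<epsilon> \<mu>" "ap G x = lam \<kappa> ?H" using G unfolding is_bij_iff by blast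
    have "x \<epsilon> \<kappa>" using x(1) \<open>\<mu> \<epsilon> \<kappa>\<close> ordinal_trans[OF kappa_ordinal] by blast
    from ap_lam[OF H this] have "ap (ap G x) x = ?H x" by (simp only: x(2)[symmetric])
    moreover have "suc zero \<noteq> zero" using mem_suc[of zero zero] not_mem_zero[of zero] by metis
    ultimately show False by (cases "ap (ap G x) x = zero") simp_all
  qed
  then show ?thesis
    using ordinal_linear[OF mu_ordinal kappa_ordinal] ordinal_trans[OF mu_ordinal] assms by blast
qed

text \<open>Padding with zeros turns \<open>g\<close> into a sequence of length exactly \<mu> of
  ordinals below \<open>j \<kappa>\<close>, so the closure hypothesis applies; \<open>M\<close> then
  restricts the sequence to \<kappa>.\<close>

lemma funs_kappa_in_M: assumes "is_fun g \<kappa> two" shows "g \<in> M"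
proof -
  let ?H = "\<lambda>x. if x \<epsilon> \<kappa> then ap g x else zero"
  have H: "definable_term (\<lambda>e. ?H (e 0))" by (intro definable_intro)
  have "?H x \<epsilon> j \<kappa>" for x
    using assms zero_kappa two_kappa kappa_subset ordinal_trans[OF kappa_ordinal] unfolding is_fun_iff by simp
  then have "lam \<mu> ?H \<in> M" by (intro closed is_fun_lam[OF H])
  then have "restr (lam \<mu> ?H) \<kappa> \<in> M" using M_restr kappa_mem M_mem j_in_M by blast
  moreover have "restr (lam \<mu> ?H) \<kappa> = g"
  proof (rule fun_ext)
    show "fun_on g \<kappa>" using assms is_fun_iff by blast
    show "fun_on (restr (lam \<mu> ?H) \<kappa>) \<kappa>"
      by (rule fun_on_restr[OF fun_on_lam[OF H]]) (simp add: is_subset_def kappa_subset_mu)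
    show "ap (restr (lam \<mu> ?H) \<kappa>) x = ap g x" if "x \<epsilon> \<kappa>" for x
      using that by (simp add: ap_restr ap_lam[OF H] kappa_subset_mu)
  qed
  ultimately show ?thesis by simp
qed

text \<open>All functions from \<kappa> to 2 lie in \<open>M\<close>, so the enumeration in
  \<open>M\<close> by an ordinal x below \<open>j \<kappa>\<close> is a bijection in V too. Thus x
  is bijective with the cardinal \<mu>, which gives \<mu> \<le> x <
  \<open>j \<kappa>\<close>.\<close>

lemma mu_mem: "\<mu> \<epsilon> j \<kappa>"
proof -
  obtain x h where x: "x \<epsilon> j \<kappa>"
    and h1: "\<forall>y. y \<epsilon> x \<longrightarrow> (\<exists>!g. pair y g \<epsilon> h)"
    and h2: "\<forall>y g. y \<epsilon> x \<and> pair y g \<epsilon> h \<longrightarrow> is_fun g \<kappa> two"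
    and h: "\<forall>g. g \<in> M \<and> is_fun g \<kappa> two \<longrightarrow> (\<exists>!y. y \<epsilon> x \<and> pair y g \<epsilon> h)"
    using funs_kappa_small_in_M by (elim exE conjE) (rule that)
  have h3: "\<exists>!y. y \<epsilon> x \<and> pair y g \<epsilon> h" if "is_fun g \<kappa> two" for g
    using h that funs_kappa_in_M by simp
  obtain G where G: "is_bij G \<mu> (funs \<kappa> two)" using mu_enumerates by blast
  have fun_G: "fun_on G \<mu>" using G is_bij_iff by blast
  \<comment> \<open>\<open>H\<close> converts the index of a function under \<open>h\<close> into
    its index under \<open>G\<close>.\<close>
  define H where "H y = the_set (\<lambda>m. \<exists>g. pair y g \<epsilon> h \<and> pair m g \<epsilon> G)" for y
  have H: "definable_term (\<lambda>e. H (e 0))" unfolding H_def by (intro definable_intro)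
  have ex1: "\<exists>!m. \<exists>g. pair y g \<epsilon> h \<and> pair m g \<epsilon> G" if "y \<epsilon> x" for y
  proof -
    obtain g where g: "pair y g \<epsilon> h" "\<And>g'. pair y g' \<epsilon> h \<Longrightarrow> g' = g" using h1 \<open>y \<epsilon> x\<close> by blast
    then have "g \<epsilon> funs \<kappa> two" using h2 \<open>y \<epsilon> x\<close> mem_funs by blast
    then obtain m where m: "m \<epsilon> \<mu>" "ap G m = g" using G is_bij_iff by blast
    show ?thesis
    proof (rule ex1I[of _ m])
      show "\<exists>g. pair y g \<epsilon> h \<and> pair m g \<epsilon> G" using g m fun_on_ap[OF fun_G] by blast
      fix m' assume "\<exists>g. pair y g \<epsilon> h \<and> pair m' g \<epsilon> G"
      then have "pair m' g \<epsilon> G" using g by blast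
      then show "m' = m" using m G unfolding is_bij_iff fun_on_ap[OF fun_G] by blast
    qed
  qed
  have Hy: "\<exists>g. pair y g \<epsilon> h \<and> pair (H y) g \<epsilon> G" if "y \<epsilon> x" for y
    unfolding H_def by (rule the_setI[OF ex1[OF that]])
  have "is_bij (lam x H) x \<mu>"
    unfolding is_bij_iff
  proof (intro conjI allI impI)
    show "fun_on (lam x H) x" by (rule fun_on_lam[OF H])
    show "ap (lam x H) y \<epsilon> \<mu>" if "y \<epsilon> x" for y
      using Hy[OF that] unfolding ap_lam[OF H that] fun_on_ap[OF fun_G] by blast
    show "\<exists>y. y \<epsilon> x \<and> ap (lam x H) y = m" if "m \<epsilon> \<mu>" for m
    proof -
      have "is_fun (ap G m) \<kappa> two" using G that unfolding is_bij_iff mem_funs by blast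
      then obtain y where y: "y \<epsilon> x" "pair y (ap G m) \<epsilon> h" using h3 by blast
      then have "H y = m" using ex1[OF y(1)] Hy[OF y(1)] that fun_on_ap[OF fun_G, of m "ap G m"] by blast
      then show ?thesis using y ap_lam[OF H y(1)] by blast
    qed
    show "y = z" if "y \<epsilon> x \<and> z \<epsilon> x \<and> ap (lam x H) y = ap (lam x H) z" for y z
    proof -
      have yx: "y \<epsilon> x" and zx: "z \<epsilon> x" and eq: "H y = H z" using that ap_lam[OF H] by auto
      obtain g where g: "pair y g \<epsilon> h" "pair (H y) g \<epsilon> G" using Hy[OF yx] by blast
      obtain g' where g': "pair z g' \<epsilon> h" "pair (H z) g' \<epsilon> G" using Hy[OF zx] by blast
      have "g = g'" using g(2) g'(2) eq unfolding fun_on_ap[OF fun_G] by simp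
      moreover have "is_fun g \<kappa> two" using h2 yx g(1) by blast
      ultimately show ?thesis using g(1) g'(1) h3[of g] yx zx by blast
    qed
  qed
  then have "\<not> x \<epsilon> \<mu>" using mu_cardinal unfolding is_cardinal_def by blast
  then show ?thesis
    using ordinal_linear[OF mu_ordinal ordinal_mem[OF j_kappa_ordinal x]] x ordinal_trans[OF j_kappa_ordinal]
    by blast
qed

text \<open>The terms of f are replaced by their indices under \<open>j B\<close>, ordinals below
  \<open>j \<kappa>\<close>, and the index sequence is padded with zeros to length \<mu>. Closure
  puts it into \<open>M\<close>, where composing its part on s with \<open>j B\<close> returns
  f.\<close>

lemma short_sequences_in_M:
  assumes B: "is_bij B \<kappa> A" and s: "s \<epsilon> suc \<mu>" and f: "is_fun f s (j A)"
  shows "f \<in> M"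
proof -
  have jB: "is_bij (j B) (j \<kappa>) (j A)" using B transfer_is_bij by blast
  have fun_jB: "fun_on (j B) (j \<kappa>)" using jB is_bij_iff by blast
  have fun_f: "fun_on f s" using f is_fun_iff by blast
  have sub: "is_subset s \<mu>" using s ordinal_subset[OF mu_ordinal] by (auto simp: is_subset_def)
  have sM: "s \<in> M" using s mu_mem M_mem[OF j_in_M] M_mem[of \<mu>] by auto
  define H where "H x = (if x \<epsilon> s then the_set (\<lambda>w. pair w (ap f x) \<epsilon> j B) else zero)" for x
  have H: "definable_term (\<lambda>e. H (e 0))" unfolding H_def by (intro definable_intro)
  have ex: "\<exists>!w. pair w (ap f x) \<epsilon> j B" if "x \<epsilon> s" for x
  proof -
    have "ap f x \<epsilon> j A" using that f is_fun_iff by blast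
    then show ?thesis using jB unfolding is_bij_def rel_iff by blast
  qed
  have Hx: "pair (H x) (ap f x) \<epsilon> j B" if "x \<epsilon> s" for x
    using the_setI[OF ex[OF that]] that by (simp add: H_def)
  have "is_fun (lam \<mu> H) \<mu> (j \<kappa>)"
  proof (rule is_fun_lam[OF H])
    fix x show "H x \<epsilon> j \<kappa>"
      using Hx[of x] fun_on_ap[OF fun_jB] zero_kappa kappa_subset by (cases "x \<epsilon> s") (auto simp: H_def)
  qed
  then have "lam \<mu> H \<in> M" by (rule closed)
  then show ?thesis
  proof (rule M_relational_composition[OF _ j_in_M sM])
    fix z
    show "z \<epsilon> f \<longleftrightarrow> (\<exists>x w y. x \<epsilon> s \<and> pair x w \<epsilon> lam \<mu> H \<and> pair w y \<epsilon> j B \<and> z = pair x y)" (is "?L \<longleftrightarrow> ?R")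
    proof
      assume ?L
      then obtain x where x: "x \<epsilon> s" "z = pair x (ap f x)" using fun_f by (blast elim: fun_onE)
      moreover have "pair x (H x) \<epsilon> lam \<mu> H" unfolding mem_lam[OF H] using is_subsetD[OF sub x(1)] by blast
      ultimately show ?R using Hx by blast
    next
      assume ?R
      then obtain x w y where x: "x \<epsilon> s" "pair x w \<epsilon> lam \<mu> H" "pair w y \<epsilon> j B" "z = pair x y" by blast
      then have "w = H x" unfolding mem_lam[OF H] pair_eq_iff by blast
      then have "y = ap f x" using Hx[OF x(1)] x(3) unfolding fun_on_ap[OF fun_jB] by simp
      then show ?L using x fun_on_ap[OF fun_f] by blast
    qed
  qed
qed

section \<open>The master condition\<close>

text \<open>Via \<open>B\<close> a subset of \<open>P\<close> becomes a characteristic function on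
  \<kappa>, with 1 marking membership, and \<open>G\<close> enumerates these functions. Definability
  of \<open>E\<close> is recorded because the recursion that builds the play refers to it.\<close>

lemma enumerate_subsets:
  assumes B: "is_bij B \<kappa> P"
  shows "\<exists>E. definable_term (\<lambda>e. E (e 0)) \<and> (\<forall>X. is_subset X P \<longrightarrow> (\<exists>t. t \<epsilon> \<mu> \<and> E t = X))"
proof -
  obtain G where G: "is_bij G \<mu> (funs \<kappa> two)" using mu_enumerates by blast
  define E where "E t = sep P (\<lambda>x. \<exists>w. pair w x \<epsilon> B \<and> pair w (suc zero) \<epsilon> ap G t)" for t
  have mem_E: "x \<epsilon> E t \<longleftrightarrow> x \<epsilon> P \<and> (\<exists>w. pair w x \<epsilon> B \<and> pair w (suc zero) \<epsilon> ap G t)" for x t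
    unfolding E_def by (rule mem_sep) (intro definable_intro)
  have "definable_term (\<lambda>e. E (e 0))" unfolding E_def by (intro definable_intro)
  moreover have "\<exists>t. t \<epsilon> \<mu> \<and> E t = X" if X: "is_subset X P" for X
  proof -
    define H where "H w = (if ap B w \<epsilon> X then suc zero else zero)" for w
    have H: "definable_term (\<lambda>e. H (e 0))" unfolding H_def by (intro definable_intro)
    have "lam \<kappa> H \<epsilon> funs \<kappa> two" unfolding mem_funs by (rule is_fun_lam[OF H]) (simp add: H_def)
    then obtain t where t: "t \<epsilon> \<mu>" "ap G t = lam \<kappa> H" using G unfolding is_bij_iff by blast
    have fun_B: "fun_on B \<kappa>" using B is_bij_iff by blast
    have "suc zero \<noteq> zero" using mem_suc[of zero zero] not_mem_zero[of zero] by metis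
    then have mem_H: "pair w (suc zero) \<epsilon> lam \<kappa> H \<longleftrightarrow> w \<epsilon> \<kappa> \<and> ap B w \<epsilon> X" for w
      unfolding mem_lam[OF H] by (auto simp: H_def)
    have "E t = X"
    proof (rule set_ext)
      fix x
      show "x \<epsilon> E t \<longleftrightarrow> x \<epsilon> X"
      proof
        assume "x \<epsilon> E t"
        then show "x \<epsilon> X" unfolding mem_E t(2) mem_H fun_on_ap[OF fun_B] by blast
      next
        assume x: "x \<epsilon> X"
        then have "x \<epsilon> P" using X is_subsetD by blast
        moreover then obtain w where "w \<epsilon> \<kappa>" "ap B w = x" using B unfolding is_bij_iff by blast
        ultimately show "x \<epsilon> E t" unfolding mem_E t(2) mem_H fun_on_ap[OF fun_B] using x by blast
      qed
    qed
    then show ?thesis using t by blast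
  qed
  ultimately show ?thesis by blast
qed

text \<open>The play is built by recursion: a choice function selects the moves of I among the
  \<open>good\<close> conditions, and the strategy supplies those of II. Induction along the play
  shows that it is legal and follows the strategy, so each step can be carried out. The move at
  \<mu> extends all others and inherits membership in every \<open>j D\<close> by openness.\<close>

lemma master_condition:
  assumes forcing: "forcing_notion P R" and B: "is_bij B \<kappa> P"
    and strat: "strategically_closed_below \<kappa> P R" and p: "p \<epsilon> P"
  shows "\<exists>q. q \<epsilon> j P \<and> rel (j R) (j p) q \<and> (\<forall>D. dense_open P R D \<longrightarrow> q \<epsilon> j D)"
proof -
  have refl: "\<And>x. x \<epsilon> j P \<Longrightarrow> rel (j R) x x"
    and trans: "\<And>x y z. x \<epsilon> j P \<Longrightarrow> y \<epsilon> j P \<Longrightarrow> z \<epsilon> j P \<Longrightarrow> rel (j R) x y \<Longrightarrow> rel (j R) y z \<Longrightarrow> rel (j R) x z"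
    using transfer_forcing_notion[OF forcing] unfolding forcing_notion_def by blast+
  have jp: "j p \<epsilon> j P" using p j_mem_iff by blast
  obtain E where E: "definable_term (\<lambda>e. E (e 0))"
    and surj: "\<And>X. is_subset X P \<Longrightarrow> \<exists>t. t \<epsilon> \<mu> \<and> E t = X"
    using enumerate_subsets[OF B] by blast
  \<comment> \<open>The game has length \<mu> + 1, so that \<mu> itself is a stage.\<close>
  have "suc \<mu> \<epsilon> j \<kappa>" using suc_j_kappa mu_mem by blast
  then obtain \<tau> d where \<tau>: "is_fun \<tau> d (j P)" and win_all:
    "\<forall>b f. f \<in> M \<and> b \<epsilon> suc \<mu> \<and> \<not> stage_of_I b \<and> is_position (j P) (j R) b f \<and> follows \<tau> b f \<longrightarrow>
      (\<exists>q. rel \<tau> f q \<and> (\<forall>s x. s \<epsilon> b \<and> rel f s x \<longrightarrow> rel (j R) x q))"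
    using transfer_strategically_closed[OF strat kappa_ordinal] by meson
  have fun_\<tau>: "fun_on \<tau> d" using \<tau> is_fun_iff by blast
  obtain c where c: "\<And>X. is_subset X (j P) \<Longrightarrow> X \<noteq> zero \<Longrightarrow> ap c X \<epsilon> X"
    using choice_function[of "j P"] by blast
  \<comment> \<open>One of \<open>t\<close> and \<open>t + 1\<close> is a stage of I, so every \<open>E t\<close> is handled by requiring it at both.\<close>
  define good where "good s f x \<longleftrightarrow> rel (j R) (j p) x \<and> (\<forall>u y. pair u y \<epsilon> f \<longrightarrow> rel (j R) y x) \<and>
    (\<forall>t. t \<epsilon> \<mu> \<and> (t = s \<or> s = suc t) \<and> dense_open P R (E t) \<longrightarrow> x \<epsilon> j (E t))" for s f x
  have good: "definable (\<lambda>e. good (t e) (s e) (u e))"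
    if "definable_term t" "definable_term s" "definable_term u" for t s u
  proof -
    have "definable (\<lambda>e. good (e 0) (e 1) (e 2))"
      unfolding good_def dense_open_def by (intro definable_intro definable_term1[OF E])
    then show ?thesis by (rule definable3) (intro that)+
  qed
  define cand where "cand s f = sep (j P) (good s f)" for s f
  have mem_cand: "x \<epsilon> cand s f \<longleftrightarrow> x \<epsilon> j P \<and> good s f x" for x s f
    unfolding cand_def by (rule mem_sep) (intro good definable_intro)
  define move where "move s f = (if stage_of_I s then ap c (cand s f) else ap \<tau> f)" for s f
  have "definable_term (\<lambda>e. move (e 0) (e 1))"
    unfolding move_def cand_def by (intro definable_intro good)
  then obtain f where f: "recursive_on move (suc \<mu>) f"
    using recursion ordinal_suc[OF mu_ordinal] by blast
  have fun_f: "fun_on f (suc \<mu>)" and ap_f: "\<And>s. s \<epsilon> suc \<mu> \<Longrightarrow> ap f s = move s (restr f s)"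
    using f unfolding recursive_on_def by blast+
  have ord: "is_ordinal s" "is_subset s (suc \<mu>)" if "s \<epsilon> suc \<mu>" for s
    using that ordinal_suc[OF mu_ordinal] ordinal_mem ordinal_subset by blast+
  \<comment> \<open>Besides the order conditions, the invariant records why each move was made:
    goodness at the stages of I, agreement with the strategy at those of II.\<close>
  define inv where "inv s \<longleftrightarrow> ap f s \<epsilon> j P \<and> rel (j R) (j p) (ap f s) \<and>
    (\<forall>u. u \<epsilon> s \<longrightarrow> rel (j R) (ap f u) (ap f s)) \<and>
    (stage_of_I s \<longrightarrow> good s (restr f s) (ap f s)) \<and>
    (\<not> stage_of_I s \<longrightarrow> pair (restr f s) (ap f s) \<epsilon> \<tau>)" for s
  have inv: "s \<epsilon> suc \<mu> \<longrightarrow> inv s" if "is_ordinal s" for s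
    using that
  proof (induction s rule: ordinal_induct)
    case definable show ?case unfolding inv_def by (intro definable_intro good)
  next
    case (step s)
    show ?case
    proof
      assume s: "s \<epsilon> suc \<mu>"
      have IH: "inv u" if "u \<epsilon> s" for u using step.IH[OF that] is_subsetD[OF ord(2)[OF s] that] by blast
      let ?r = "restr f s"
      have fun_r: "fun_on ?r s" by (rule fun_on_restr[OF fun_f ord(2)[OF s]])
      have mem_r: "pair u y \<epsilon> ?r \<longleftrightarrow> u \<epsilon> s \<and> y = ap f u" for u y
        using fun_on_ap[OF fun_r, of u y] ap_restr[of u s f] by auto
      show "inv s"
      proof (cases "stage_of_I s")
        case True
        \<comment> \<open>A stage of I is zero or a successor. So \<open>x0\<close> is
          \<open>j p\<close> or the preceding move and bounds all earlier moves, and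
          \<open>u\<close> is the predecessor stage, with zero as a placeholder at the
          opening.\<close>
        obtain x0 u where x0: "x0 \<epsilon> j P" "rel (j R) (j p) x0" "\<And>v. v \<epsilon> s \<Longrightarrow> rel (j R) (ap f v) x0"
          and u: "\<And>t. s = suc t \<Longrightarrow> t = u"
        proof (cases "s = zero")
          case True
          have "suc t \<noteq> zero" for t using mem_suc[of t t] not_mem_zero[of t] by metis
          then show ?thesis using True jp refl by (intro that[of "j p" zero]) auto
        next
          case False
          then obtain u where u: "s = suc u" using \<open>stage_of_I s\<close> stage_of_I_cases[OF step.hyps] by blast
          then have "inv u" using IH by simp
          then show ?thesis using u refl suc_inject
            by (intro that[of "ap f u" u]) (auto simp: inv_def)
        qed
        \<comment> \<open>The clause about \<open>X\<close> is conditional, so this can be applied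
          to \<open>E s\<close> and \<open>E u\<close> without knowing whether they are dense
          open.\<close>
        have extend: "\<exists>y. y \<epsilon> j P \<and> rel (j R) x y \<and> (dense_open P R X \<longrightarrow> y \<epsilon> j X)" if "x \<epsilon> j P" for x X
        proof (cases "dense_open P R X")
          case True
          from transfer_dense_open[OF this] show ?thesis
            using that unfolding dense_open_def is_subset_def by blast
        qed (use that refl in blast)
        obtain y where y: "y \<epsilon> j P" "rel (j R) x0 y" "dense_open P R (E s) \<longrightarrow> y \<epsilon> j (E s)"
          using extend[OF x0(1)] by blast
        obtain z where z: "z \<epsilon> j P" "rel (j R) y z" "dense_open P R (E u) \<longrightarrow> z \<epsilon> j (E u)"
          using extend[OF y(1)] by blast
        have x0z: "rel (j R) x0 z" using trans x0(1) y(1,2) z(1,2) by blast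
        \<comment> \<open>Openness of \<open>j (E s)\<close> keeps the further extension
          \<open>z\<close> inside it, so \<open>z\<close> meets both requirements.\<close>
        have "dense_open P R (E s) \<longrightarrow> z \<epsilon> j (E s)"
          using y(3) z(1,2) transfer_dense_open[of P R "E s"] unfolding dense_open_def by blast
        moreover have "rel (j R) (j p) z" using trans[OF jp x0(1) z(1) x0(2) x0z] .
        moreover have "rel (j R) (ap f v) z" if "v \<epsilon> s" for v
          using trans[OF _ x0(1) z(1) x0(3)[OF that] x0z] IH[OF that] unfolding inv_def by blast
        ultimately have "good s ?r z" unfolding good_def mem_r using u z(3) by blast
        then have "z \<epsilon> cand s ?r" using z(1) mem_cand by blast
        then have "cand s ?r \<noteq> zero" by auto
        moreover have "is_subset (cand s ?r) (j P)" unfolding is_subset_def mem_cand by blast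
        ultimately have "ap f s \<epsilon> cand s ?r" using c ap_f[OF s] True by (simp add: move_def)
        then have "ap f s \<epsilon> j P" and g: "good s ?r (ap f s)" unfolding mem_cand by blast+
        then show ?thesis using True g[unfolded good_def mem_r] unfolding inv_def by blast
      next
        case False
        have r: "is_fun ?r s (j P)"
          unfolding is_fun_iff using fun_r IH by (simp add: ap_restr inv_def)
        have "is_position (j P) (j R) s ?r"
          unfolding is_position_def rel_iff[of ?r] mem_r using r IH by (auto simp: inv_def)
        moreover have "follows \<tau> s ?r"
          unfolding follows_iff rel_iff mem_r
        proof (intro allI impI, elim conjE)
          fix u assume u: "u \<epsilon> s" "\<not> stage_of_I u"
          then have "pair (restr ?r u) (ap f u) \<epsilon> \<tau>"
            using IH restr_restr[OF ordinal_subset[OF step.hyps u(1)]] by (simp add: inv_def)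
          then show "\<exists>y. pair (restr ?r u) y \<epsilon> \<tau> \<and> u \<epsilon> s \<and> y = ap f u" using u by blast
        qed
        \<comment> \<open>The strategy is only known to answer positions in \<open>M\<close>. The
          play is built in V, but its initial segment of length s \<le> \<mu> lies in
          \<open>M\<close> by \<open>short_sequences_in_M\<close>.\<close>
        ultimately obtain q where q: "pair ?r q \<epsilon> \<tau>" "\<And>u x. u \<epsilon> s \<Longrightarrow> pair u x \<epsilon> ?r \<Longrightarrow> rel (j R) x q"
          using win_all short_sequences_in_M[OF B s r] s False by (metis rel_iff)
        then have q\<tau>: "q = ap \<tau> ?r" "?r \<epsilon> d" using fun_on_ap[OF fun_\<tau>, of ?r q] by blast+
        then have qs: "q = ap f s" using ap_f[OF s] False by (simp add: move_def)
        have qP: "q \<epsilon> j P" using q\<tau> \<tau> unfolding is_fun_iff by blast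
        have le: "rel (j R) (ap f u) q" if "u \<epsilon> s" for u using q(2) that mem_r by blast
        \<comment> \<open>Player I opens, so every stage of II has stage zero below it, and the move
          there is already above \<open>j p\<close>.\<close>
        have "zero \<epsilon> s"
          using ordinal_linear[OF ordinal_zero step.hyps] False stage_of_I_cases[OF step.hyps] by auto
        then have "rel (j R) (j p) q"
          using IH[of zero] le[of zero] trans[OF jp _ qP] unfolding inv_def by blast
        then show ?thesis using q(1) le qP False unfolding inv_def qs by blast
      qed
    qed
  qed
  let ?q = "ap f \<mu>"
  have q: "inv \<mu>" using inv[OF mu_ordinal] by simp
  have "?q \<epsilon> j D" if D: "dense_open P R D" for D
  proof -
    obtain t where t: "t \<epsilon> \<mu>" "E t = D" using surj D unfolding dense_open_def by blast
    have ord_t: "is_ordinal t" by (rule ordinal_mem[OF mu_ordinal t(1)])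
    \<comment> \<open>For t below \<mu> the stage t + 1 is at most \<mu>, hence still part of the
      play.\<close>
    obtain s where s: "s \<epsilon> suc \<mu>" "stage_of_I s" "t = s \<or> s = suc t"
    proof (cases "stage_of_I t")
      case True then show ?thesis using t by (intro that[of t]) auto
    next
      case False
      then have "stage_of_I (suc t)" using stage_of_I_cases[OF ordinal_suc[OF ord_t]] by blast
      then show ?thesis using suc_mem_suc[OF mu_ordinal t(1)] by (intro that[of "suc t"]) auto
    qed
    then have inv_s: "inv s" using inv ord by blast
    then have "ap f s \<epsilon> j D" using s(2,3) t D unfolding inv_def good_def by blast
    moreover have "s = \<mu> \<or> rel (j R) (ap f s) ?q" using s(1) q unfolding inv_def by auto
    ultimately show ?thesis
      using transfer_dense_open[OF D] q unfolding inv_def dense_open_def by blast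
  qed
  then show ?thesis using q unfolding inv_def by blast
qed

end

section \<open>The ultrafilter generated by the master condition through the embedding\<close>

theorem theorem5p1:
  fixes M :: "'v::set_structure set" and j :: "'v \<Rightarrow> 'v" and \<kappa> \<mu> P R :: 'v
  assumes "ZFC_model M j"
    and "transitive_class M"
    and "elementary_embedding j M"
    and "critical_point j \<kappa>"
    and "is_two_power \<mu> \<kappa>"
    and "\<forall>f. is_fun f \<mu> (j \<kappa>) \<longrightarrow> f \<in> M"
    and "forcing_notion P R"
    and "is_card_of \<kappa> P"
    and "strategically_closed_below \<kappa> P R"
  shows "\<forall>p. p \<epsilon> P \<longrightarrow>
    (\<exists>U. is_ultrafilter P U \<and> complete_filter \<kappa> P U \<and> (\<forall>X. in_D P R p X \<longrightarrow> X \<epsilon> U))"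
proof (intro allI impI)
  interpret closed_embedding M j \<kappa> \<mu> by unfold_locales (use assms in blast)+
  fix p assume p: "p \<epsilon> P"
  obtain B where B: "is_bij B \<kappa> P" using assms(8) unfolding is_card_of_def by blast
  obtain q where qP: "q \<epsilon> j P" and qp: "rel (j R) (j p) q" and qD: "\<And>D. dense_open P R D \<Longrightarrow> q \<epsilon> j D"
    using master_condition[OF assms(7) B assms(9) p] by blast
  \<comment> \<open>\<open>U\<close> is a set in V because Separation admits formulas that mention
    \<open>j\<close>.\<close>
  define U where "U = sep (Pow_set P) (\<lambda>X. q \<epsilon> j X)"
  have U: "X \<epsilon> U \<longleftrightarrow> is_subset X P \<and> q \<epsilon> j X" for X
    unfolding U_def mem_Pow_set[symmetric] by (rule mem_sep) (intro definable_intro)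
  \<comment> \<open>Transferred equivalences hold only for elements of \<open>M\<close>, and each of
    them is evaluated at \<open>q\<close>.\<close>
  have qM: "q \<in> M" using qP M_mem j_in_M by blast
  have mono: "q \<epsilon> j Y" if "is_subset X Y" "q \<epsilon> j X" for X Y
  proof -
    have "\<forall>z. z \<epsilon> j X \<longrightarrow> z \<epsilon> j Y"
      using that(1)[unfolded is_subset_def] by (rule transferD) (intro transfer_intro)
    then show ?thesis using that by blast
  qed
  have inter: "q \<epsilon> j Z" if "\<forall>z. z \<epsilon> Z \<longleftrightarrow> z \<epsilon> X \<and> z \<epsilon> Y" "q \<epsilon> j X" "q \<epsilon> j Y" for X Y Z
  proof -
    have "\<forall>z\<in>M. z \<epsilon> j Z \<longleftrightarrow> z \<epsilon> j X \<and> z \<epsilon> j Y"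
      using that(1) by (rule transferD) (intro transfer_intro)
    then show ?thesis using that qM by blast
  qed
  have filter: "is_filter P U"
    unfolding is_filter_def U using mono inter qP by (auto simp: is_subset_def)
  have compl: "q \<epsilon> j X \<or> q \<epsilon> j Y" if "\<forall>z. z \<epsilon> Y \<longleftrightarrow> z \<epsilon> P \<and> \<not> z \<epsilon> X" for X Y
  proof -
    have "\<forall>z\<in>M. z \<epsilon> j Y \<longleftrightarrow> z \<epsilon> j P \<and> \<not> z \<epsilon> j X"
      using that by (rule transferD) (intro transfer_intro)
    then show ?thesis using qP qM by blast
  qed
  have "is_ultrafilter P U"
    unfolding is_ultrafilter_def
  proof (intro conjI allI impI, rule filter)
    show "\<not> X \<epsilon> U" if "is_empty X" for X using that by (simp add: U)
    show "X \<epsilon> U \<or> Y \<epsilon> U" if "is_subset X P \<and> (\<forall>z. z \<epsilon> Y \<longleftrightarrow> z \<epsilon> P \<and> \<not> z \<epsilon> X)" for X Y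
      using that compl[of Y X] unfolding U by (simp add: is_subset_def)
  qed
  moreover have "complete_filter \<kappa> P U"
    unfolding complete_filter_def
  proof (intro allI impI, elim conjE)
    fix a S Y
    assume a: "a \<epsilon> \<kappa>" and S: "is_fun S a U" and Y: "\<forall>z. z \<epsilon> Y \<longleftrightarrow> z \<epsilon> P \<and> (\<forall>i X. rel S i X \<longrightarrow> z \<epsilon> X)"
    \<comment> \<open>The image of the intersection is the intersection of the family
      \<open>j S\<close>. Its index set is \<open>j a\<close> = \<open>a\<close>, and its member at
      i = \<open>j i\<close> is \<open>j (ap S i)\<close>, which contains \<open>q\<close> because
      \<open>ap S i\<close> is in \<open>U\<close>.\<close>
    have "\<forall>z\<in>M. z \<epsilon> j Y \<longleftrightarrow> z \<epsilon> j P \<and> (\<forall>i\<in>M. \<forall>X\<in>M. rel (j S) i X \<longrightarrow> z \<epsilon> X)"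
      using Y by (rule transferD) (intro transfer_intro)
    moreover have "q \<epsilon> X" if iX: "rel (j S) i X" for i X
    proof -
      have fun_S: "fun_on S a" using S is_fun_iff by blast
      have jS: "is_fun (j S) (j a) (j U)"
        using S by (rule transferD) (intro transfers_is_fun transfers_term_const)
      then have fun_jS: "fun_on (j S) a" using is_fun_iff j_fixed[OF a] by simp
      then have i: "i \<epsilon> a" "X = ap (j S) i" using iX unfolding rel_iff by (simp_all add: fun_on_ap)
      then have "j i = i" using a ordinal_trans[OF kappa_ordinal] j_fixed by blast
      moreover have "pair i (ap S i) \<epsilon> S" using i fun_on_ap[OF fun_S] by blast
      ultimately have "pair i (j (ap S i)) \<epsilon> j S" using j_mem_iff[of "pair i (ap S i)" S] by (simp add: j_pair)
      then have "X = j (ap S i)" using i fun_on_ap[OF fun_jS] by simp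
      moreover have "ap S i \<epsilon> U" using S i is_fun_iff by blast
      ultimately show ?thesis using U by blast
    qed
    ultimately have "q \<epsilon> j Y" using qP qM by blast
    then show "Y \<epsilon> U" unfolding U using Y by (simp add: is_subset_def)
  qed
  moreover have "X \<epsilon> U" if "in_D P R p X" for X
  proof -
    \<comment> \<open>As \<open>U\<close> is a filter on \<open>P\<close>, minimality of the
      generated filter reduces the claim to the generators: dense open sets are handled by the
      choice of \<open>q\<close>, and the cone by \<open>q\<close> being above
      \<open>j p\<close>.\<close>
    have "Y \<epsilon> U" if "D_generator P R p Y" for Y
      using that unfolding D_generator_def
    proof
      assume "dense_open P R Y"
      then show "Y \<epsilon> U" using qD unfolding U dense_open_def by blast
    next
      assume Y: "\<forall>x. x \<epsilon> Y \<longleftrightarrow> x \<epsilon> P \<and> rel R p x"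
      then have "\<forall>x\<in>M. x \<epsilon> j Y \<longleftrightarrow> x \<epsilon> j P \<and> rel (j R) (j p) x"
        by (rule transferD) (intro transfer_intro)
      then show "Y \<epsilon> U" using qP qp qM Y unfolding U is_subset_def by blast
    qed
    then show ?thesis using that filter unfolding in_D_def by blast
  qed
  ultimately show "\<exists>U. is_ultrafilter P U \<and> complete_filter \<kappa> P U \<and> (\<forall>X. in_D P R p X \<longrightarrow> X \<epsilon> U)"
    by blast
qed

end
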